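(* There exists $q_0$ such that for every even integer $q\geq q_0$ and every integer $t$ with $1\leq t<q^{1/8}/30$ the following holds. Let $G$ be a graph on $q^2+q+1$ vertices with $\frac12 q(q+1)^2+t$ edges. Then either $G$ has at least $(t+1)q-(t+1)^2$ copies of $C_4$, or $G$ is obtained from an orthogonal polarity graph of order $q$ by adding $t$ new edges. In particular, $G$ has at least $t(q-1)$ copies of $C_4$.
   Context: Copies of $C_4$ are distinct subgraphs isomorphic to the $4$-cycle. A finite projective plane of order $q$ is a pair $(P,\mathcal L)$ with $|P|=q^2+q+1$ and $\mathcal L$ a family of $(q+1)$-subsets (lines) such that each point lies on exactly $q+1$ lines and two distinct lines meet in exactly one point. A polarity is a bijection $\pi:P\cup\mathcal L\to P\cup\mathcal L$ with $\pi^2=\mathrm{id}$, exchanging $P$ and $\mathcal L$, with $x\in L\Rightarrow\pi(L)\in\pi(x)$; it is orthogonal if exactly $q+1$ points $x$ satisfy $x\in\pi(x)$. Its polarity graph is the simple graph on $P$ with distinct $x,y$ adjacent iff $x\in\pi(y)$; an orthogonal polarity graph of order $q$ is the polarity graph of an orthogonal polarity of a projective plane of order $q$. *)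

theory Defs
  imports Complex_Main
begin

section \<open>Finite simple graphs\<close>

text \<open>A graph is a pair of a vertex set and a set of edges; an edge is a two-element set of
  vertices.\<close>

type_synonym 'a graph = "'a set \<times> 'a set set"

definition verts :: "'a graph \<Rightarrow> 'a set" where
  "verts G = fst G"

definition edges :: "'a graph \<Rightarrow> 'a set set" where
  "edges G = snd G"

definition simple_graph :: "'a graph \<Rightarrow> bool" where
  "simple_graph G \<longleftrightarrow> finite (verts G) \<and> (\<forall>e\<in>edges G. e \<subseteq> verts G \<and> card e = 2)"

definition subgraph_of :: "'a graph \<Rightarrow> 'a graph \<Rightarrow> bool" where
  "subgraph_of H G \<longleftrightarrow> simple_graph H \<and> verts H \<subseteq> verts G \<and> edges H \<subseteq> edges G"

definition graph_isomorphic :: "'a graph \<Rightarrow> 'b graph \<Rightarrow> bool" where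
  "graph_isomorphic G H \<longleftrightarrow>
     (\<exists>f. bij_betw f (verts G) (verts H) \<and> edges H = (\<lambda>e. f ` e) ` edges G)"

definition C4 :: "nat graph" where
  "C4 = ({0, 1, 2, 3}, {{0, 1}, {1, 2}, {2, 3}, {3, 0}})"

definition C4_copies :: "'a graph \<Rightarrow> 'a graph set" where
  "C4_copies G = {H. subgraph_of H G \<and> graph_isomorphic H C4}"

section \<open>Projective planes and polarities\<close>

definition projective_plane :: "nat \<Rightarrow> 'a set \<Rightarrow> 'a set set \<Rightarrow> bool" where
  "projective_plane q P L \<longleftrightarrow>
     card P = q\<^sup>2 + q + 1 \<and>
     (\<forall>l\<in>L. l \<subseteq> P \<and> card l = q + 1) \<and>
     (\<forall>x\<in>P. card {l \<in> L. x \<in> l} = q + 1) \<and>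
     (\<forall>l\<in>L. \<forall>m\<in>L. l \<noteq> m \<longrightarrow> card (l \<inter> m) = 1)"

text \<open>The (disjoint) union of points and lines is the sum \<open>P <+> L\<close>. A polarity \<open>p\<close> exchanges the
  two summands, so that \<open>projr (p (Inl x))\<close> is the line assigned to the point \<open>x\<close> and
  \<open>projl (p (Inr l))\<close> is the point assigned to the line \<open>l\<close>.\<close>

definition polarity :: "'a set \<Rightarrow> 'a set set \<Rightarrow> ('a + 'a set \<Rightarrow> 'a + 'a set) \<Rightarrow> bool" where
  "polarity P L p \<longleftrightarrow>
     bij_betw p (P <+> L) (P <+> L) \<and>
     (\<forall>z \<in> P <+> L. p (p z) = z) \<and>
     p ` (Inl ` P) = Inr ` L \<and>
     p ` (Inr ` L) = Inl ` P \<and>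
     (\<forall>x\<in>P. \<forall>l\<in>L. x \<in> l \<longrightarrow> projl (p (Inr l)) \<in> projr (p (Inl x)))"

definition orthogonal_polarity ::
    "nat \<Rightarrow> 'a set \<Rightarrow> 'a set set \<Rightarrow> ('a + 'a set \<Rightarrow> 'a + 'a set) \<Rightarrow> bool" where
  "orthogonal_polarity q P L p \<longleftrightarrow>
     polarity P L p \<and> card {x \<in> P. x \<in> projr (p (Inl x))} = q + 1"

definition polarity_graph :: "'a set \<Rightarrow> ('a + 'a set \<Rightarrow> 'a + 'a set) \<Rightarrow> 'a graph" where
  "polarity_graph P p =
     (P, {{x, y} | x y. x \<in> P \<and> y \<in> P \<and> x \<noteq> y \<and> x \<in> projr (p (Inl y))})"

definition orthogonal_polarity_graph :: "nat \<Rightarrow> 'a graph \<Rightarrow> bool" where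
  "orthogonal_polarity_graph q H \<longleftrightarrow>
     (\<exists>P L p. projective_plane q P L \<and> orthogonal_polarity q P L p \<and> H = polarity_graph P p)"

definition obtained_by_adding_edges :: "nat \<Rightarrow> 'a graph \<Rightarrow> 'a graph \<Rightarrow> bool" where
  "obtained_by_adding_edges t H G \<longleftrightarrow>
     simple_graph G \<and> verts G = verts H \<and>
     (\<exists>F. finite F \<and> card F = t \<and> F \<inter> edges H = {} \<and> edges G = edges H \<union> F)"

end

(* A symmetric relation R on q^2+q+1 vertices is read as an incidence structure: line v is the set of
   all w with R v w. Write x(v) = q + 1 - |line v|, E(v) for the number of excess common points of line v
   with the other lines and Z(v) for the number of lines disjoint from line v. Then
   Z(v) - E(v) = q x(v) + sum of x over line v.

   If G has few quadrilaterals, the sum of the E(v) is O(tq). This identity, Cauchy-Schwarz and the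
   parity argument (q is even, so a vertex of degree q + 1 outside all quadrilaterals has a neighbour
   with which it shares no neighbour) show that, up to O(t) vertices, all degrees are q + 1 except for
   about q vertices of degree q, and that almost every vertex v has its disjoint neighbour among the
   latter. After adding loops at the vertices of degree q, both the sum of |x| and the sum of E divided
   by q are O(t).

   In such a structure two lines with two common points force Z or E to be of order q at one of them. So
   all these pairs meet a set X of O(t) vertices, and deleting R on X x X leaves a partial linear space
   with O(t^2) missing flags, which can be completed to a polarity of a projective plane.

   Hence G differs from a polarity graph H in s missing and r additional edges with s = O(t^2). There are
   at least q + 1 absolute points, so r >= t + s, and each additional edge lies in at least q - 1 - s
   quadrilaterals that contain no other additional edge. *)

theory Submission
  imports Defs "HOL-Analysis.Convex" "HOL-Library.Z2" "HOL-Library.Disjoint_Sets"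
begin

text \<open>Only the sum of all defects is known at the start, so large degrees could be balanced by
  small ones. They are controlled through a budget: summing the identity over all vertices leaves
  room for about 2 q^2 ordered pairs of disjoint lines. The vertices of degree q + 1 outside all
  quadrilaterals claim about q^2 of these by the parity argument, and each unit of positive defect
  claims about q. So the positive defects add up to little more than q, and few of those vertices
  can have a second disjoint line.

  Missing flags can be located because they leave large traces: a line of defect d is disjoint from
  about d q lines, and nearly all of these pass through d points, which are the points to be added.

  Pruning leaves K = O(m^2) missing flags with m = O(t), and the completion tolerates them once q
  exceeds a multiple of K^2; hence the fourth power of t in the lower bound on q.

  In the final count a missing edge forces one more additional edge, worth about q quadrilaterals,
  and costs every additional edge only one.\<close>

lemma Cauchy_Schwarz_int:
  fixes a b :: "'a \<Rightarrow> int"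
  shows "(\<Sum>i\<in>I. a i * b i)\<^sup>2 \<le> (\<Sum>i\<in>I. (a i)\<^sup>2) * (\<Sum>i\<in>I. (b i)\<^sup>2)"
proof -
  have "real_of_int ((\<Sum>i\<in>I. a i * b i)\<^sup>2) \<le> real_of_int ((\<Sum>i\<in>I. (a i)\<^sup>2) * (\<Sum>i\<in>I. (b i)\<^sup>2))"
    using Cauchy_Schwarz_ineq_sum[of "\<lambda>i. real_of_int (a i)" "\<lambda>i. real_of_int (b i)" I] by simp
  then show ?thesis by linarith
qed

text \<open>Over the field with two elements, the terms exchanged by an involution without fixed
  points cancel, so the sum of ones over \<open>X\<close>, the parity of \<open>card X\<close>,
  would vanish.\<close>

lemma involution_fixed_point:
  assumes "odd (card X)" and h: "\<And>x. x \<in> X \<Longrightarrow> h x \<in> X" "\<And>x. x \<in> X \<Longrightarrow> h (h x) = x"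
  shows "\<exists>x\<in>X. h x = x"
proof (rule ccontr)
  assume "\<not> ?thesis"
  then have "(\<Sum>x\<in>X. 1 :: bit) = 0"
    by (intro sum_involution_eq_0[where h = h]) (auto simp: h)
  then have "even (of_nat (card X) :: bit)" by simp
  then show False using assms(1) even_of_nat by blast
qed

section \<open>Symmetric incidence structures\<close>

locale sym_structure =
  fixes V :: "'a set" and R :: "'a \<Rightarrow> 'a \<Rightarrow> bool" and q :: nat
  assumes fin: "finite V" and card_V: "card V = q\<^sup>2 + q + 1"
    and sym: "R u v \<Longrightarrow> R v u"
begin

definition line :: "'a \<Rightarrow> 'a set" where
  "line v = {w \<in> V. R v w}"

definition meet :: "'a \<Rightarrow> 'a \<Rightarrow> nat" where
  "meet u v = card (line u \<inter> line v)"

definition defect :: "'a \<Rightarrow> int" where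
  "defect v = int q + 1 - int (card (line v))"

text \<open>The subtraction is truncated: a line disjoint from \<open>line v\<close> contributes 0
  here and is recorded by \<open>missed v\<close> instead.\<close>

definition excess :: "'a \<Rightarrow> nat" where
  "excess v = (\<Sum>u\<in>V - {v}. meet u v - 1)"

definition missed :: "'a \<Rightarrow> 'a set" where
  "missed v = {u \<in> V - {v}. line u \<inter> line v = {}}"

lemma line_subset: "line v \<subseteq> V"
  by (auto simp: line_def)

lemma finite_line [simp]: "finite (line v)"
  using finite_subset[OF line_subset fin] .

lemma missed_subset: "missed v \<subseteq> V"
  by (auto simp: missed_def)

lemma finite_missed [simp]: "finite (missed v)"
  using finite_subset[OF missed_subset fin] .

lemma line_sym: "u \<in> V \<Longrightarrow> v \<in> line u \<Longrightarrow> u \<in> line v"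
  using sym by (auto simp: line_def)

lemma missed_sym: "u \<in> V \<Longrightarrow> v \<in> missed u \<Longrightarrow> u \<in> missed v"
  by (auto simp: missed_def)

lemma meet_commute: "meet u v = meet v u"
  by (simp add: meet_def Int_commute)

section \<open>Double counting of flags\<close>

lemma sum_line_swap:
  fixes g :: "'a \<Rightarrow> 'a \<Rightarrow> 'b::comm_monoid_add"
  assumes "A \<subseteq> V" "B \<subseteq> V"
  shows "(\<Sum>u\<in>A. \<Sum>w\<in>line u \<inter> B. g u w) = (\<Sum>w\<in>B. \<Sum>u\<in>line w \<inter> A. g u w)"
proof -
  have fA: "finite A" "finite B" using assms fin finite_subset by auto
  have 1: "line u \<inter> B = {w\<in>B. R u w}" for u using assms by (auto simp: line_def)
  have 2: "line w \<inter> A = {u\<in>A. R u w}" for w using assms by (auto simp: line_def sym)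
  show ?thesis unfolding 1 2 by (rule sum.swap_restrict[OF fA])
qed

lemma sum_card_swap:
  assumes "A \<subseteq> V" "B \<subseteq> V"
  shows "(\<Sum>u\<in>A. card (line u \<inter> B)) = (\<Sum>w\<in>B. card (line w \<inter> A))"
  using sum_line_swap[OF assms, of "\<lambda>_ _. 1::nat"] by simp

lemma line_Int_V [simp]: "line v \<inter> V = line v" "V \<inter> line v = line v"
  using line_subset by auto

lemma sum_weight_swap:
  fixes g :: "'a \<Rightarrow> int"
  assumes "A \<subseteq> V"
  shows "(\<Sum>u\<in>A. \<Sum>w\<in>line u. g w) = (\<Sum>w\<in>V. int (card (line w \<inter> A)) * g w)"
  using sum_line_swap[OF assms subset_refl, of "\<lambda>_ w. g w"] by simp

text \<open>Double counting of the flags on the points of \<open>line v\<close>. A line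
  \<open>u\<close> other than \<open>v\<close> contributes \<open>meet u v\<close>, that is 1 plus
  its share of the excess, minus 1 if it is missed. With \<open>q + 1\<close> points per line and
  \<open>q^2 + q\<close> other lines everything would cancel; the defects remain.\<close>

lemma missed_minus_excess:
  assumes "v \<in> V"
  shows "int (card (missed v)) - int (excess v) = int q * defect v + (\<Sum>w\<in>line v. defect w)"
proof -
  have a: "(\<Sum>u\<in>V. meet u v) = (\<Sum>w\<in>line v. card (line w))"
    using sum_card_swap[OF subset_refl line_subset, of v] by (simp add: meet_def)
  have b: "(\<Sum>u\<in>V. meet u v) = card (line v) + (\<Sum>u\<in>V-{v}. meet u v)"
    using sum.remove[OF fin assms, of "\<lambda>u. meet u v"] by (simp add: meet_def)
  have c: "(\<Sum>u\<in>V-{v}. int (meet u v)) =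
      (\<Sum>u\<in>V-{v}. int (meet u v - 1) + 1 - (if u \<in> missed v then 1 else 0))"
  proof (rule sum.cong[OF refl])
    fix u assume "u \<in> V - {v}"
    then have "u \<in> missed v \<longleftrightarrow> meet u v = 0" by (auto simp: missed_def meet_def)
    then show "int (meet u v) = int (meet u v - 1) + 1 - (if u \<in> missed v then 1 else 0)" by auto
  qed
  have d: "(\<Sum>u\<in>V-{v}. int (meet u v - 1) + 1 - (if u \<in> missed v then 1 else 0)) =
     int (excess v) + int (card (V-{v})) - (\<Sum>u\<in>V-{v}. if u \<in> missed v then 1 else 0)"
    by (simp add: sum.distrib sum_subtractf excess_def)
  have e: "(\<Sum>u\<in>V-{v}. if u \<in> missed v then (1::int) else 0) = int (card (missed v))"
  proof -
    have "(V-{v}) \<inter> missed v = missed v" by (auto simp: missed_def)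
    then show ?thesis using fin by (simp add: sum.If_cases)
  qed
  have f: "int (card (V-{v})) = int q * (int q + 1)"
    using assms fin card_V by (simp add: power2_eq_square algebra_simps)
  have g: "(\<Sum>w\<in>line v. defect w) = (int q + 1) * int (card (line v)) - int (\<Sum>w\<in>line v. card (line w))"
    by (simp add: defect_def sum_subtractf mult.commute)
  have h: "int (\<Sum>w\<in>line v. card (line w)) = int (card (line v)) + (\<Sum>u\<in>V-{v}. int (meet u v))"
    using a b by (simp flip: of_nat_sum)
  have "(\<Sum>w\<in>line v. defect w) = (int q + 1) * int (card (line v)) -
     (int (card (line v)) + (int (excess v) + int q * (int q + 1) - int (card (missed v))))"
    unfolding g h c d e f ..
  then show ?thesis by (simp add: defect_def algebra_simps)
qed

lemma sum_meet_le:
  assumes "X \<subseteq> V"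
  shows "(\<Sum>u\<in>X. meet u v) \<le> card (line v) + card X + excess v"
proof -
  have fX: "finite X" using assms fin finite_subset by auto
  have "(\<Sum>u\<in>X. meet u v) \<le> meet v v + (\<Sum>u\<in>X-{v}. meet u v)"
    using fX by (cases "v \<in> X") (simp_all add: sum.remove)
  also have "(\<Sum>u\<in>X-{v}. meet u v) \<le> (\<Sum>u\<in>X-{v}. 1 + (meet u v - 1))"
    by (rule sum_mono) auto
  also have "\<dots> = card (X-{v}) + (\<Sum>u\<in>X-{v}. meet u v - 1)" by (simp only: sum.distrib card_eq_sum)
  also have "(\<Sum>u\<in>X-{v}. meet u v - 1) \<le> excess v" unfolding excess_def
    by (rule sum_mono2) (use assms fin in auto)
  also have "card (X-{v}) \<le> card X" using fX by (simp add: card_mono)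
  finally show ?thesis by (simp add: meet_def)
qed

text \<open>The squares count ordered pairs of lines from \<open>X\<close> together with a common
  point. The diagonal gives the line sizes, and any other pair contributes at most 1 beyond the
  excess.\<close>

lemma sum_square_line:
  assumes "X \<subseteq> V"
  shows "(\<Sum>y\<in>V. (card (line y \<inter> X))\<^sup>2)
    \<le> (\<Sum>v\<in>X. card (line v)) + (card X)\<^sup>2 + (\<Sum>v\<in>V. excess v)"
proof -
  have "(\<Sum>y\<in>V. (card (line y \<inter> X))\<^sup>2) = (\<Sum>y\<in>V. \<Sum>v\<in>line y \<inter> X. card (line y \<inter> X))"
    by (simp add: power2_eq_square)
  also have "\<dots> = (\<Sum>v\<in>X. \<Sum>y\<in>line v \<inter> V. card (line y \<inter> X))"
    by (rule sum_line_swap[OF subset_refl assms])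
  also have "\<dots> = (\<Sum>v\<in>X. \<Sum>u\<in>X. meet u v)"
    using sum_card_swap[OF line_subset assms] by (simp add: meet_def)
  also have "\<dots> \<le> (\<Sum>v\<in>X. card (line v) + card X + excess v)"
    by (rule sum_mono) (rule sum_meet_le[OF assms])
  also have "\<dots> = (\<Sum>v\<in>X. card (line v)) + (card X)\<^sup>2 + (\<Sum>v\<in>X. excess v)"
    by (simp add: sum.distrib power2_eq_square)
  also have "(\<Sum>v\<in>X. excess v) \<le> (\<Sum>v\<in>V. excess v)"
    by (rule sum_mono2) (use assms fin in auto)
  finally show ?thesis by simp
qed

lemma sum_pairs_line:
  assumes "X \<subseteq> V"
  shows "(\<Sum>y\<in>V. (int (card (line y \<inter> X)))\<^sup>2 - int (card (line y \<inter> X)))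
    \<le> int ((card X)\<^sup>2 + (\<Sum>v\<in>V. excess v))"
proof -
  have "(\<Sum>y\<in>V. int (card (line y \<inter> X))) = int (\<Sum>v\<in>X. card (line v))"
    using sum_card_swap[OF subset_refl assms] by (simp flip: of_nat_sum)
  moreover have "(\<Sum>y\<in>V. (int (card (line y \<inter> X)))\<^sup>2) = int (\<Sum>y\<in>V. (card (line y \<inter> X))\<^sup>2)"
    by simp
  ultimately show ?thesis using sum_square_line[OF assms] unfolding sum_subtractf by linarith
qed

text \<open>A point on \<open>e\<close> of the lines satisfies \<open>e <= 1 + (e^2 - e)\<close>:
  one for the point itself, the rest is charged to the pairs of lines through it.\<close>

lemma sum_line_Int_le:
  assumes "X \<subseteq> V" "D \<subseteq> V"
  shows "(\<Sum>v\<in>X. card (line v \<inter> D)) \<le> card D + (card X)\<^sup>2 + (\<Sum>v\<in>V. excess v)"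
proof -
  let ?e = "\<lambda>y. int (card (line y \<inter> X))"
  have ge: "0 \<le> (?e y)\<^sup>2 - ?e y" for y
    by (cases "card (line y \<inter> X)") (auto simp: power2_eq_square)
  have "int (\<Sum>v\<in>X. card (line v \<inter> D)) = (\<Sum>y\<in>D. ?e y)"
    using sum_card_swap[OF assms] by simp
  also have "\<dots> \<le> (\<Sum>y\<in>D. 1 + ((?e y)\<^sup>2 - ?e y))"
  proof (rule sum_mono)
    fix y
    have "0 \<le> (?e y - 1)\<^sup>2" by simp
    then show "?e y \<le> 1 + ((?e y)\<^sup>2 - ?e y)" by (simp add: power2_eq_square algebra_simps)
  qed
  also have "\<dots> = int (card D) + (\<Sum>y\<in>D. (?e y)\<^sup>2 - ?e y)"
    by (simp only: sum.distrib card_eq_sum of_nat_sum of_nat_1)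
  also have "(\<Sum>y\<in>D. (?e y)\<^sup>2 - ?e y) \<le> (\<Sum>y\<in>V. (?e y)\<^sup>2 - ?e y)"
    by (rule sum_mono2[OF fin assms(2)]) (rule ge)
  also have "\<dots> \<le> int ((card X)\<^sup>2 + (\<Sum>v\<in>V. excess v))"
    by (rule sum_pairs_line[OF assms(1)])
  finally show ?thesis by linarith
qed

lemma card_rich_lines_less:
  assumes "X \<subseteq> V" "D \<subseteq> V" and rich: "\<And>v. v \<in> X \<Longrightarrow> r \<le> card (line v \<inter> D)"
    and s: "card D + s\<^sup>2 + (\<Sum>v\<in>V. excess v) < s * r"
  shows "card X < s"
proof (rule ccontr)
  assume "\<not> ?thesis"
  \<comment> \<open>The incidence bound is quadratic in the number of lines, so it is applied to
    exactly \<open>s\<close> of them and not to all of \<open>X\<close>.\<close>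
  then obtain Y where Y: "Y \<subseteq> X" "card Y = s" by (metis not_less obtain_subset_with_card_n)
  have "s * r = (\<Sum>v\<in>Y. r)" using Y by simp
  also have "\<dots> \<le> (\<Sum>v\<in>Y. card (line v \<inter> D))" by (rule sum_mono) (use rich Y in auto)
  also have "\<dots> \<le> card D + s\<^sup>2 + (\<Sum>v\<in>V. excess v)"
    using sum_line_Int_le[of Y D] Y assms by auto
  finally show False using s by simp
qed

section \<open>Pairs of lines with two common points\<close>

lemma meet_le_Suc_excess:
  assumes "u \<in> V" "u \<noteq> v"
  shows "meet u v \<le> 1 + excess v"
proof -
  have "meet u v - 1 \<le> excess v" unfolding excess_def
    by (rule member_le_sum) (use assms fin in auto)
  then show ?thesis by simp
qed

text \<open>Outside \<open>D\<close>, the \<open>q\<close> lines other than \<open>line b\<close> through a point \<open>y\<close> of \<open>line b\<close> meet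
  \<open>line u\<close> in different points, none of them \<open>v\<close> or \<open>a\<close>. That leaves only \<open>q - 1\<close> points, so
  one of these lines misses \<open>line u\<close>, and different \<open>y\<close> give different lines.\<close>

lemma double_meet_missed:
  assumes V: "u \<in> V" "b \<in> V" and ub: "u \<noteq> b"
    and du: "defect u = 0" and db: "defect b = 0"
    and va: "v \<noteq> a" "v \<in> line u \<inter> line b" "a \<in> line u \<inter> line b"
    and D: "\<And>y. y \<in> V - D \<Longrightarrow> defect y = 0 \<and> excess y = 0"
  shows "q + 1 \<le> card (missed u) + meet u b + card (line b \<inter> D)"
proof -
  define Y where "Y = line b - line u - D"
  have "\<exists>z. z \<in> missed u \<and> z \<in> line y - {b}" if y: "y \<in> Y" for y
  proof (rule ccontr)
    assume neg: "\<not> ?thesis"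
    have yV: "y \<in> V" "y \<notin> D" "y \<in> line b" "y \<notin> line u" using y line_subset by (auto simp: Y_def)
    have one: "meet p y \<le> 1" if "p \<in> V" "p \<noteq> y" for p
      using meet_le_Suc_excess[OF that] D[of y] yV by simp
    have "\<exists>p. p \<in> line z \<inter> line u" if "z \<in> line y - {b}" for z
    proof -
      have "z \<in> V" "z \<noteq> u" using that line_subset line_sym[OF yV(1), of z] yV by auto
      then show ?thesis using neg that by (auto simp: missed_def)
    qed
    then obtain p where p: "\<And>z. z \<in> line y - {b} \<Longrightarrow> p z \<in> line z \<inter> line u" by metis
    have pV: "p z \<in> V \<and> p z \<noteq> y" if "z \<in> line y - {b}" for z
      using p[OF that] line_subset yV by auto
    have uniq: "z = z'" if "z \<in> line y" "z' \<in> line y" "w \<in> line z" "w \<in> line z'" "w \<noteq> y" for z z' w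
    proof -
      have zV: "z \<in> V" "z' \<in> V" and wV: "w \<in> V" using that line_subset by auto
      have "{z, z'} \<subseteq> line w \<inter> line y" using that line_sym zV by auto
      then have "card {z, z'} \<le> meet w y" unfolding meet_def by (intro card_mono) auto
      then show ?thesis using one[OF wV that(5)] by (cases "z = z'") auto
    qed
    have by': "b \<in> line y" using line_sym[OF V(2)] yV by auto
    have sub: "p ` (line y - {b}) \<subseteq> line u - {v, a}"
    proof
      fix w assume "w \<in> p ` (line y - {b})"
      then obtain z where z: "z \<in> line y - {b}" "w = p z" by auto
      have "w \<noteq> c" if "c \<in> line u \<inter> line b" for c
      proof
        assume "w = c"
        then have "z = b" using uniq[of z b c] z p[of z] that by' yV by auto
        then show False using z by simp
      qed
      then show "w \<in> line u - {v, a}" using p[OF z(1)] z va by auto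
    qed
    have "inj_on p (line y - {b})"
    proof (rule inj_onI)
      fix z z' assume h: "z \<in> line y - {b}" "z' \<in> line y - {b}" "p z = p z'"
      show "z = z'" using uniq[of z z' "p z"] h p[of z] p[of z'] pV[of z] by auto
    qed
    then have "card (line y - {b}) \<le> card (line u - {v, a})"
      using sub by (intro card_inj_on_le) auto
    moreover have "card (line u - {v, a}) = card (line u) - 2"
      using va by (subst card_Diff_subset) auto
    moreover have "card (line y - {b}) = card (line y) - 1" using by' by simp
    moreover have "card (line y) = q + 1" "card (line u) = q + 1"
      using D[of y] yV du by (auto simp: defect_def)
    moreover have "card (line u) \<ge> 2"
    proof -
      have "card {v, a} \<le> card (line u)" using va by (intro card_mono) auto
      then show ?thesis using va by simp
    qed
    ultimately show False by linarith
  qed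
  then obtain z where z: "\<And>y. y \<in> Y \<Longrightarrow> z y \<in> missed u \<and> z y \<in> line y - {b}" by metis
  have "inj_on z Y"
  proof (rule inj_onI)
    fix y y' assume h: "y \<in> Y" "y' \<in> Y" "z y = z y'"
    show "y = y'"
    proof (rule ccontr)
      assume ne: "y \<noteq> y'"
      have yV: "y \<in> V" "y' \<in> V" "y \<notin> D" "y \<in> line b" "y' \<in> line b"
        using h line_subset by (auto simp: Y_def)
      have "{z y, b} \<subseteq> line y' \<inter> line y" using z[OF h(1)] z[OF h(2)] h line_sym[OF V(2)] yV by auto
      then have "card {z y, b} \<le> meet y' y" unfolding meet_def by (intro card_mono) auto
      moreover have "meet y' y \<le> 1" using meet_le_Suc_excess[of y' y] ne yV D[of y] by auto
      ultimately show False using z[OF h(1)] by auto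
    qed
  qed
  then have "card Y \<le> card (missed u)" using z by (intro card_inj_on_le) auto
  moreover have "card (line b) \<le> card (Y \<union> (line u \<inter> line b) \<union> (line b \<inter> D))"
    by (intro card_mono) (auto simp: Y_def)
  moreover have "card (Y \<union> (line u \<inter> line b) \<union> (line b \<inter> D)) \<le> card Y + meet u b + card (line b \<inter> D)"
    unfolding meet_def by (metis add_le_mono1 card_Un_le le_trans)
  moreover have "card (line b) = q + 1" using db by (simp add: defect_def)
  ultimately show ?thesis by linarith
qed


lemma pair_in_meet:
  assumes "2 \<le> meet u b"
  obtains v a where "v \<noteq> a" "v \<in> line u \<inter> line b" "a \<in> line u \<inter> line b"
proof -
  obtain T where "T \<subseteq> line u \<inter> line b" "card T = 2"
    using assms obtain_subset_with_card_n unfolding meet_def by metis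
  then show ?thesis using that by (auto simp: card_2_iff)
qed

text \<open>The set \<open>X\<close> collects the lines of wrong size, those of large excess and
  those with many irregular points. For \<open>u\<close> and \<open>b\<close> outside
  \<open>X\<close>, each of the three terms in \<open>double_meet_missed\<close> is at most about
  \<open>q / 10\<close>, far from a sum of \<open>q + 1\<close>. The three parts have at most
  \<open>m\<close>, \<open>11 * m\<close> and \<open>60 * m\<close> elements.\<close>

lemma double_meet_cover:
  assumes dm: "(\<Sum>v\<in>V. \<bar>defect v\<bar>) \<le> int m" and em: "(\<Sum>v\<in>V. excess v) \<le> m * q"
    and m: "1 \<le> m" and q: "10000 * m \<le> q"
  obtains X where "X \<subseteq> V" "card X \<le> 72 * m"
    "\<And>u b. u \<in> V \<Longrightarrow> b \<in> V \<Longrightarrow> u \<noteq> b \<Longrightarrow> 2 \<le> meet u b \<Longrightarrow> u \<in> X \<or> b \<in> X"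
proof -
  define r where "r = q div 10"
  have r: "q \<le> 10 * r + 9" "10 * r \<le> q" "900 * m \<le> r" using q m by (auto simp: r_def)
  define X1 where "X1 = {v\<in>V. defect v \<noteq> 0}"
  define X2 where "X2 = {v\<in>V. r \<le> excess v}"
  define D where "D = {v\<in>V. excess v > 0 \<or> defect v \<noteq> 0}"
  define X3 where "X3 = {v\<in>V. r \<le> card (line v \<inter> D)}"
  have fs: "finite X1" "finite X2" "finite X3" "finite D"
    using fin by (auto simp: X1_def X2_def X3_def D_def)
  have "int (card X1) = (\<Sum>v\<in>X1. 1)" by simp
  also have "\<dots> \<le> (\<Sum>v\<in>X1. \<bar>defect v\<bar>)" by (rule sum_mono) (auto simp: X1_def)
  also have "\<dots> \<le> (\<Sum>v\<in>V. \<bar>defect v\<bar>)" by (rule sum_mono2[OF fin]) (auto simp: X1_def)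
  finally have c1: "card X1 \<le> m" using dm by linarith
  have "card X2 * r = (\<Sum>v\<in>X2. r)" by simp
  also have "\<dots> \<le> (\<Sum>v\<in>X2. excess v)" by (rule sum_mono) (auto simp: X2_def)
  also have "\<dots> \<le> (\<Sum>v\<in>V. excess v)" by (rule sum_mono2[OF fin]) (auto simp: X2_def)
  also have "\<dots> \<le> m * q" by (rule em)
  also have "\<dots> \<le> m * (11 * r)" using r m by (intro mult_le_mono) auto
  finally have "card X2 * r \<le> (11 * m) * r" by (simp add: mult_ac)
  then have c2: "card X2 \<le> 11 * m" using r m by simp
  have "card (D - X1) = (\<Sum>v\<in>D-X1. 1)" by simp
  also have "\<dots> \<le> (\<Sum>v\<in>D-X1. excess v)" by (rule sum_mono) (auto simp: X1_def D_def)
  also have "\<dots> \<le> (\<Sum>v\<in>V. excess v)" by (rule sum_mono2[OF fin]) (auto simp: D_def)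
  finally have "card (D - X1) \<le> m * q" using em by simp
  moreover have "card D \<le> card ((D - X1) \<union> X1)" using fs by (intro card_mono) auto
  moreover have "card ((D - X1) \<union> X1) \<le> card (D-X1) + card X1" by (rule card_Un_le)
  moreover have "m \<le> m * q" using q m by (cases q) auto
  ultimately have cD: "card D \<le> 2 * (m * q)" using c1 by linarith
  have c3: "card X3 < 60 * m"
  proof (rule card_rich_lines_less[where D = D and r = r])
    have "card D + (60 * m)\<^sup>2 + (\<Sum>v\<in>V. excess v) \<le> 3 * (m * q) + 3600 * (m * m)"
      using cD em by (simp add: power2_eq_square)
    also have "\<dots> \<le> 3 * (m * (11 * r)) + 3600 * (m * m)"
      using r m by (intro add_mono mult_le_mono) auto
    also have "\<dots> \<le> 33 * (m * r) + 4 * (m * r)"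
    proof -
      have "m * (900 * m) \<le> m * r" using r by (intro mult_le_mono) auto
      then show ?thesis by simp
    qed
    also have "\<dots> < 60 * m * r" using r m by simp
    finally show "card D + (60 * m)\<^sup>2 + (\<Sum>v\<in>V. excess v) < 60 * m * r" .
  qed (auto simp: X3_def D_def)
  define X where "X = X1 \<union> X2 \<union> X3"
  have "card X \<le> card X1 + card X2 + card X3" unfolding X_def
    by (metis add_le_mono1 card_Un_le le_trans)
  then have "card X \<le> 72 * m" using c1 c2 c3 by linarith
  moreover have "X \<subseteq> V" by (auto simp: X_def X1_def X2_def X3_def)
  moreover have "u \<in> X \<or> b \<in> X" if ub: "u \<in> V" "b \<in> V" "u \<noteq> b" "2 \<le> meet u b" for u b
  proof (rule ccontr)
    assume "\<not> ?thesis"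
    then have nX: "defect u = 0" "defect b = 0" "excess u < r" "excess b < r" "card (line b \<inter> D) < r"
      using ub by (auto simp: X_def X1_def X2_def X3_def)
    obtain v a where va: "v \<noteq> a" "v \<in> line u \<inter> line b" "a \<in> line u \<inter> line b"
      using pair_in_meet[OF ub(4)] .
    have "q + 1 \<le> card (missed u) + meet u b + card (line b \<inter> D)"
      by (rule double_meet_missed[OF ub(1-3) nX(1,2) va]) (auto simp: D_def)
    moreover have "meet u b \<le> 1 + excess b" by (rule meet_le_Suc_excess[OF ub(1,3)])
    moreover have "int (card (missed u)) \<le> int (excess u) + int m"
    proof -
      have "(\<Sum>w\<in>line u. defect w) \<le> (\<Sum>w\<in>line u. \<bar>defect w\<bar>)" by (rule sum_mono) simp
      also have "\<dots> \<le> (\<Sum>w\<in>V. \<bar>defect w\<bar>)" by (rule sum_mono2[OF fin line_subset]) simp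
      finally show ?thesis using missed_minus_excess[OF ub(1)] nX dm by simp
    qed
    ultimately show False using nX r m by linarith
  qed
  ultimately show ?thesis using that by blast
qed

text \<open>A quadruple \<open>u\<close>, \<open>b\<close>, \<open>v\<close>, \<open>a\<close> with \<open>{v, a} \<subseteq> line u \<inter> line b\<close> also has
  \<open>{u, b} \<subseteq> line v \<inter> line a\<close>, so one of its four flags lies in \<open>X \<times> X\<close>.\<close>

lemma prune:
  assumes dm: "(\<Sum>v\<in>V. \<bar>defect v\<bar>) \<le> int m" and em: "(\<Sum>v\<in>V. excess v) \<le> m * q"
    and m: "1 \<le> m" and q: "10000 * m \<le> q"
  obtains R' where "sym_structure V R' q" "\<forall>u v. R' u v \<longrightarrow> R u v"
    "\<forall>u\<in>V. \<forall>b\<in>V. u \<noteq> b \<longrightarrow> sym_structure.meet V R' u b \<le> 1"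
    "(\<Sum>v\<in>V. \<bar>sym_structure.defect V R' q v\<bar>) \<le> int (5200 * m\<^sup>2)"
proof -
  obtain X where X: "X \<subseteq> V" "card X \<le> 72 * m"
    "\<And>u b. u \<in> V \<Longrightarrow> b \<in> V \<Longrightarrow> u \<noteq> b \<Longrightarrow> 2 \<le> meet u b \<Longrightarrow> u \<in> X \<or> b \<in> X"
    using double_meet_cover[OF assms] by metis
  define R' where "R' = (\<lambda>u v. R u v \<and> \<not> (u \<in> X \<and> v \<in> X))"
  interpret S: sym_structure V R' q
    by standard (use fin card_V sym in \<open>auto simp: R'_def\<close>)
  have fX: "finite X" using X(1) fin finite_subset by auto
  have lineS: "S.line v = (if v \<in> X then line v - X else line v)" for v
    unfolding S.line_def line_def by (auto simp: R'_def)
  have le1: "S.meet u b \<le> 1" if ub: "u \<in> V" "b \<in> V" "u \<noteq> b" for u b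
  proof (rule ccontr)
    assume "\<not> ?thesis"
    then obtain v a where va: "v \<noteq> a" "v \<in> S.line u \<inter> S.line b" "a \<in> S.line u \<inter> S.line b"
      using S.pair_in_meet[of u b] by auto
    have vaV: "v \<in> V" "a \<in> V" using va S.line_subset by auto
    have "{v, a} \<subseteq> line u \<inter> line b" using va by (auto simp: lineS split: if_splits)
    then have "card {v, a} \<le> meet u b" unfolding meet_def by (intro card_mono) auto
    then have 1: "u \<in> X \<or> b \<in> X" using X(3)[OF ub] va by simp
    have "{u, b} \<subseteq> line v \<inter> line a"
      using va line_sym[OF ub(1)] line_sym[OF ub(2)] by (auto simp: lineS split: if_splits)
    then have "card {u, b} \<le> meet v a" unfolding meet_def by (intro card_mono) auto
    then have "v \<in> X \<or> a \<in> X" using X(3)[OF vaV va(1)] ub by simp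
    then show False using 1 va by (auto simp: lineS)
  qed
  have sumS: "(\<Sum>v\<in>V. \<bar>S.defect v\<bar>) \<le> int (5200 * m\<^sup>2)"
  proof -
    have "\<bar>S.defect v\<bar> \<le> \<bar>defect v\<bar> + (if v \<in> X then int (card X) else 0)" for v
    proof (cases "v \<in> X")
      case True
      have "card (line v - X) \<le> card (line v)" by (rule card_mono) auto
      moreover have "card (line v) - card X \<le> card (line v - X)" by (rule diff_card_le_card_Diff[OF fX])
      ultimately show ?thesis using True by (simp add: S.defect_def defect_def lineS)
    qed (simp add: S.defect_def defect_def lineS)
    then have "(\<Sum>v\<in>V. \<bar>S.defect v\<bar>) \<le> (\<Sum>v\<in>V. \<bar>defect v\<bar> + (if v \<in> X then int (card X) else 0))"
      by (rule sum_mono)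
    also have "\<dots> = (\<Sum>v\<in>V. \<bar>defect v\<bar>) + int (card X * card X)"
      using X(1) fin by (simp add: sum.distrib sum.If_cases Int_absorb1)
    also have "\<dots> \<le> int m + int ((72 * m) * (72 * m))"
      using dm X(2) by (intro add_mono) (simp_all only: of_nat_le_iff mult_le_mono)
    \<comment> \<open>Here \<open>72 * 72 = 5184\<close>, and the linear term \<open>m\<close> is
      absorbed too.\<close>
    also have "\<dots> \<le> int (5200 * m\<^sup>2)"
      using m by (cases m) (auto simp: power2_eq_square algebra_simps)
    finally show ?thesis .
  qed
  show ?thesis
  proof (rule that[OF S.sym_structure_axioms _ _ sumS])
    show "\<forall>u v. R' u v \<longrightarrow> R u v" by (simp add: R'_def)
    show "\<forall>u\<in>V. \<forall>b\<in>V. u \<noteq> b \<longrightarrow> S.meet u b \<le> 1" using le1 by blast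
  qed
qed

end

section \<open>Completing a nearly complete polarity\<close>

text \<open>\<open>K\<close> bounds the number of missing flags. The condition on \<open>q\<close>
  makes exceptional sets of order \<open>K^2\<close>, such as \<open>busy\<close> below, small
  compared with a line.\<close>

locale sparse_structure = sym_structure +
  fixes K :: nat
  assumes meet_le: "u \<in> V \<Longrightarrow> v \<in> V \<Longrightarrow> u \<noteq> v \<Longrightarrow> meet u v \<le> 1"
    and defect_sum: "(\<Sum>v\<in>V. \<bar>defect v\<bar>) \<le> int K"
    and K_pos: "1 \<le> K" and q_large: "100 * K\<^sup>2 \<le> q"
begin

lemma K_le: "K \<le> K\<^sup>2" "100 * K \<le> q"
proof -
  show 1: "K \<le> K\<^sup>2" using K_pos by (simp add: power2_eq_square)
  show "100 * K \<le> q" using 1 q_large by linarith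
qed

lemma excess_0: "v \<in> V \<Longrightarrow> excess v = 0"
  using meet_le by (auto simp: excess_def)

lemma sum_excess_0: "(\<Sum>v\<in>V. excess v) = 0"
  using excess_0 by simp

lemma sum_defect_le:
  assumes "A \<subseteq> V"
  shows "(\<Sum>w\<in>A. defect w) \<le> int K"
proof -
  have "(\<Sum>w\<in>A. defect w) \<le> (\<Sum>w\<in>A. \<bar>defect w\<bar>)" by (rule sum_mono) simp
  also have "\<dots> \<le> (\<Sum>w\<in>V. \<bar>defect w\<bar>)" by (rule sum_mono2[OF fin assms]) simp
  finally show ?thesis using defect_sum by simp
qed

lemma card_missed: "v \<in> V \<Longrightarrow> int (card (missed v)) = int q * defect v + (\<Sum>w\<in>line v. defect w)"
  using missed_minus_excess[of v] excess_0[of v] by simp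

text \<open>A negative defect lowers the number of missed lines by at least \<open>q\<close>, and
  the defects of the points on the line can make up for at most \<open>K\<close> of that.\<close>

lemma defect_nonneg:
  assumes "v \<in> V" shows "0 \<le> defect v"
proof (rule ccontr)
  assume "\<not> ?thesis"
  then have "int q * defect v \<le> int q * (-1)" by (intro mult_left_mono) auto
  then show False using card_missed[OF assms] sum_defect_le[OF line_subset, of v] K_le K_pos by linarith
qed

lemma defect_le: "v \<in> V \<Longrightarrow> defect v \<le> int K"
  using sum_defect_le[of "{v}"] by simp

lemma line_meet_unique:
  assumes "y \<in> V" "p \<in> V" "y \<noteq> p" "w \<in> line y \<inter> line p" "w' \<in> line y \<inter> line p"
  shows "w = w'"
proof -
  have "card {w, w'} \<le> meet y p" unfolding meet_def using assms by (intro card_mono) auto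
  then show ?thesis using meet_le[OF assms(1-3)] by (cases "w = w'") auto
qed

text \<open>This is the projection from \<open>p\<close>: by symmetry the elements of
  \<open>line p\<close> are the lines through \<open>p\<close>, and each of them that meets
  \<open>line u\<close> is sent to the common point. As \<open>p\<close> is not on
  \<open>line u\<close>, different lines through \<open>p\<close> hit different points.\<close>

lemma card_line_Diff_missed_le:
  assumes "u \<in> V" "p \<in> V" "p \<notin> line u"
  shows "card (line p - missed u) \<le> card (line u - missed p)"
proof -
  have "\<exists>y. y \<in> line w \<inter> line u" if "w \<in> line p - missed u" for w
  proof -
    have "w \<in> V" "w \<noteq> u" using that line_subset line_sym[OF assms(2), of w] assms by auto
    then show ?thesis using that by (auto simp: missed_def)
  qed
  then obtain y where y: "\<And>w. w \<in> line p - missed u \<Longrightarrow> y w \<in> line w \<inter> line u" by metis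
  have yp: "y w \<in> V \<and> y w \<noteq> p \<and> w \<in> line (y w) \<inter> line p" if "w \<in> line p - missed u" for w
    using y[OF that] that assms line_subset line_sym[of w "y w"] by auto
  have "inj_on y (line p - missed u)"
  proof (rule inj_onI)
    fix w w' assume h: "w \<in> line p - missed u" "w' \<in> line p - missed u" "y w = y w'"
    show "w = w'" using line_meet_unique[of "y w" p w w'] yp[OF h(1)] yp[OF h(2)] h assms by auto
  qed
  moreover have "y ` (line p - missed u) \<subseteq> line u - missed p"
    using y yp by (fastforce simp: missed_def)
  ultimately show ?thesis by (intro card_inj_on_le) auto
qed

text \<open>The projection can be reversed, so it is a bijection between what remains of the two
  lines. Their sizes then differ only in the parts left out.\<close>

lemma card_line_missed:
  assumes "u \<in> V" "p \<in> V" "p \<notin> line u"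
  shows "int (card (line p \<inter> missed u)) - int (card (line u \<inter> missed p)) = defect u - defect p"
proof -
  have "u \<notin> line p" using assms line_sym by auto
  then have "card (line p - missed u) = card (line u - missed p)"
    using card_line_Diff_missed_le assms by (simp add: antisym)
  moreover have "card (line p) = card (line p \<inter> missed u) + card (line p - missed u)"
    "card (line u) = card (line u \<inter> missed p) + card (line u - missed p)"
    by (simp_all add: card_Int_Diff)
  ultimately show ?thesis unfolding defect_def by linarith
qed

section \<open>Locating the missing flags\<close>

definition deficient :: "'a set" where
  "deficient = {v \<in> V. defect v > 0}"

text \<open>If \<open>line z\<close> has two deficient points, it is ambiguous which of them
  accounts for the lines that \<open>z\<close> fails to meet; such \<open>z\<close> are set aside.
  They are few, since two deficient points lie on at most one common line.\<close>

definition busy :: "'a set" where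
  "busy = {z \<in> V. 2 \<le> card (line z \<inter> deficient)}"

lemma deficient_subset: "deficient \<subseteq> V"
  by (auto simp: deficient_def)

lemma finite_deficient [simp]: "finite deficient"
  using finite_subset[OF deficient_subset fin] .

lemma finite_busy [simp]: "finite busy"
  using fin by (auto simp: busy_def)

lemma card_deficient: "card deficient \<le> K"
proof -
  have "int (card deficient) = (\<Sum>v\<in>deficient. 1)" by simp
  also have "\<dots> \<le> (\<Sum>v\<in>deficient. defect v)" by (rule sum_mono) (auto simp: deficient_def)
  finally show ?thesis using sum_defect_le[OF deficient_subset] by simp
qed

lemma card_busy: "card busy \<le> K\<^sup>2"
proof -
  let ?e = "\<lambda>y. int (card (line y \<inter> deficient))"
  have "int (card busy) = (\<Sum>v\<in>busy. 1)" by simp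
  also have "\<dots> \<le> (\<Sum>v\<in>busy. (?e v)\<^sup>2 - ?e v)"
  proof (rule sum_mono)
    fix v assume "v \<in> busy"
    then have "2 * ?e v \<le> ?e v * ?e v" "2 \<le> ?e v" by (auto simp: busy_def intro!: mult_right_mono)
    then show "1 \<le> (?e v)\<^sup>2 - ?e v" unfolding power2_eq_square by linarith
  qed
  also have "\<dots> \<le> (\<Sum>v\<in>V. (?e v)\<^sup>2 - ?e v)"
  proof (rule sum_mono2[OF fin])
    show "0 \<le> (?e y)\<^sup>2 - ?e y" for y
      by (cases "card (line y \<inter> deficient)") (auto simp: power2_eq_square)
  qed (auto simp: busy_def)
  also have "\<dots> \<le> int ((card deficient)\<^sup>2)"
    using sum_pairs_line[OF deficient_subset] sum_excess_0 by simp
  finally have "card busy \<le> (card deficient)\<^sup>2" by linarith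
  also have "\<dots> \<le> K\<^sup>2" using card_deficient by (rule power_mono) simp
  finally show ?thesis .
qed

text \<open>Counting \<open>missed u\<close> from \<open>z\<close>: every other element is missed by
  \<open>z\<close> or lies on \<open>line p\<close> for some point \<open>p\<close> of
  \<open>line z\<close>. By the projection, a point \<open>p\<close> without defect accounts for
  only about \<open>defect u - 1\<close> elements besides \<open>z\<close>, in total about
  \<open>q * (defect u - 1)\<close>. But \<open>missed u\<close> has at least
  \<open>q * defect u\<close> elements, so a deficient point of \<open>line z\<close> has to supply
  the other \<open>q\<close>.\<close>

lemma exists_pole:
  assumes u: "u \<in> deficient" and z: "z \<in> missed u" "z \<notin> deficient" "z \<notin> busy"
  obtains p where "line z \<inter> deficient = {p}" "q \<le> card (line p \<inter> missed u) + 3 * K"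
proof -
  have V: "u \<in> V" "z \<in> V" and du: "1 \<le> defect u"
    using assms missed_subset deficient_subset by (auto simp: deficient_def)
  have dz: "defect z = 0" using z(2) V(2) defect_nonneg[OF V(2)] by (simp add: deficient_def)
  have disj: "line z \<inter> line u = {}" using z by (auto simp: missed_def)
  let ?a = "\<lambda>p. int (card (line p \<inter> missed u))"
  have "card (missed u) \<le> card (insert z (missed z \<union> (\<Union>p\<in>line z. line p \<inter> missed u - {z})))"
  proof (rule card_mono)
    show "missed u \<subseteq> insert z (missed z \<union> (\<Union>p\<in>line z. line p \<inter> missed u - {z}))"
    proof
      fix w assume w: "w \<in> missed u"
      have wV: "w \<in> V" using w missed_subset by auto
      show "w \<in> insert z (missed z \<union> (\<Union>p\<in>line z. line p \<inter> missed u - {z}))"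
      proof (cases "w = z \<or> w \<in> missed z")
        case False
        then obtain p where "p \<in> line w" "p \<in> line z" using wV by (auto simp: missed_def)
        then show ?thesis using line_sym[OF wV, of p] False w by auto
      qed auto
    qed
  qed auto
  also have "\<dots> \<le> 1 + (card (missed z) + (\<Sum>p\<in>line z. card (line p \<inter> missed u - {z})))"
  proof -
    have "card (insert z A) \<le> 1 + card A" if "finite A" for A :: "'a set"
      using that by (simp add: card_insert_if)
    moreover have "card (missed z \<union> (\<Union>p\<in>line z. line p \<inter> missed u - {z}))
       \<le> card (missed z) + (\<Sum>p\<in>line z. card (line p \<inter> missed u - {z}))"
      by (rule order_trans[OF card_Un_le add_left_mono[OF card_UN_le]]) simp
    moreover have "finite (missed z \<union> (\<Union>p\<in>line z. line p \<inter> missed u - {z}))" by simp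
    ultimately show ?thesis by (meson add_left_mono le_trans)
  qed
  \<comment> \<open>Since \<open>z\<close> lies on every one of these lines, leaving it out saves
    one element per point; this turns \<open>defect u\<close> into
    \<open>defect u - 1\<close>.\<close>
  also have "(\<Sum>p\<in>line z. card (line p \<inter> missed u - {z})) = (\<Sum>p\<in>line z. card (line p \<inter> missed u) - 1)"
    using line_sym[OF V(2)] z by (intro sum.cong) auto
  finally have "int (card (missed u)) \<le> 1 + int (card (missed z)) + (\<Sum>p\<in>line z. int (card (line p \<inter> missed u) - 1))"
    by (simp flip: of_nat_sum)
  also have "(\<Sum>p\<in>line z. int (card (line p \<inter> missed u) - 1)) = (\<Sum>p\<in>line z. ?a p - 1)"
  proof (rule sum.cong[OF refl])
    fix p assume "p \<in> line z"
    then have "z \<in> line p \<inter> missed u" using line_sym[OF V(2)] z by auto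
    then have "card (line p \<inter> missed u) > 0" by (auto simp: card_gt_0_iff)
    then show "int (card (line p \<inter> missed u) - 1) = ?a p - 1" by auto
  qed
  also have "\<dots> = (\<Sum>p\<in>line z - deficient. ?a p - 1) + (\<Sum>p\<in>line z \<inter> deficient. ?a p - 1)"
    by (subst sum.Int_Diff[where B = deficient]) auto
  also have "(\<Sum>p\<in>line z - deficient. ?a p - 1) \<le> (\<Sum>p\<in>line z - deficient. (defect u - 1) + (\<Sum>w\<in>line p. defect w))"
  proof (rule sum_mono)
    fix p assume p: "p \<in> line z - deficient"
    then have pV: "p \<in> V" "p \<notin> line u" using line_subset disj by auto
    have dp: "defect p = 0" using p pV defect_nonneg[OF pV(1)] by (simp add: deficient_def)
    have "card (line u \<inter> missed p) \<le> card (missed p)" by (rule card_mono) auto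
    then show "?a p - 1 \<le> (defect u - 1) + (\<Sum>w\<in>line p. defect w)"
      using card_line_missed[OF V(1) pV] card_missed[OF pV(1)] dp by simp
  qed
  also have "\<dots> = int (card (line z - deficient)) * (defect u - 1) + (\<Sum>p\<in>line z - deficient. \<Sum>w\<in>line p. defect w)"
    by (simp add: sum.distrib)
  also have "int (card (line z - deficient)) * (defect u - 1) \<le> (int q + 1) * (defect u - 1)"
  proof (rule mult_right_mono)
    have "card (line z - deficient) \<le> card (line z)" by (rule card_mono) auto
    then show "int (card (line z - deficient)) \<le> int q + 1" using dz by (simp add: defect_def)
  qed (use du in auto)
  also have "(\<Sum>p\<in>line z - deficient. \<Sum>w\<in>line p. defect w) \<le> (\<Sum>p\<in>line z. \<Sum>w\<in>line p. defect w)"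
    using line_subset by (intro sum_mono2 sum_nonneg) (auto intro!: defect_nonneg sum_nonneg)
  also have "(\<Sum>p\<in>line z. \<Sum>w\<in>line p. defect w) = (\<Sum>w\<in>V. int (meet w z) * defect w)"
    using sum_weight_swap[OF line_subset[of z]] by (simp add: meet_def)
  also have "\<dots> \<le> (\<Sum>w\<in>V. defect w)"
  proof (rule sum_mono)
    fix w assume w: "w \<in> V"
    show "int (meet w z) * defect w \<le> defect w"
    proof (cases "w = z")
      case False
      then have "int (meet w z) * defect w \<le> 1 * defect w"
        using meet_le[OF w V(2)] defect_nonneg[OF w] by (intro mult_right_mono) auto
      then show ?thesis by simp
    qed (simp add: dz)
  qed
  also have "\<dots> \<le> int K" by (rule sum_defect_le) simp
  finally have main: "int (card (missed u)) \<le> 1 + int (card (missed z)) +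
     ((int q + 1) * (defect u - 1) + int K + (\<Sum>p\<in>line z \<inter> deficient. ?a p - 1))" by simp
  moreover have "int (card (missed z)) \<le> int K"
    using card_missed[OF V(2)] dz sum_defect_le[OF line_subset] by simp
  moreover have "int q * defect u \<le> int (card (missed u))"
  proof -
    have "0 \<le> (\<Sum>w\<in>line u. defect w)" using line_subset by (intro sum_nonneg defect_nonneg) auto
    then show ?thesis using card_missed[OF V(1)] by simp
  qed
  moreover have "(int q + 1) * (defect u - 1) = int q * defect u + defect u - int q - 1"
    by (simp add: algebra_simps)
  ultimately have big: "int q \<le> (\<Sum>p\<in>line z \<inter> deficient. ?a p - 1) + 3 * int K"
    using defect_le[OF V(1)] by linarith
  have "line z \<inter> deficient \<noteq> {}" using big K_le K_pos by auto
  moreover have "card (line z \<inter> deficient) < 2" using z V by (auto simp: busy_def)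
  ultimately have "card (line z \<inter> deficient) = 1"
    using card_gt_0_iff[of "line z \<inter> deficient"] by simp
  then obtain p where p: "line z \<inter> deficient = {p}" by (auto simp: card_1_singleton_iff)
  then show ?thesis using big that by simp
qed


text \<open>The points that \<open>line u\<close> lacks: were \<open>p\<close> on
  \<open>line u\<close>, no line through \<open>p\<close> would be missed by \<open>u\<close>, so a
  crowd of missed lines through \<open>p\<close> gives it away. The threshold is the bound on
  \<open>card (deficient \<union> busy)\<close>; above it, \<open>line p\<close> contains a
  \<open>z\<close> to which \<open>exists_pole\<close> applies.\<close>

definition poles :: "'a \<Rightarrow> 'a set" where
  "poles u = (if u \<in> deficient then {p \<in> deficient. 2 * K\<^sup>2 < card (line p \<inter> missed u)} else {})"

lemma poles_deficient: "p \<in> poles u \<Longrightarrow> u \<in> deficient \<and> p \<in> deficient"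
  by (auto simp: poles_def split: if_splits)

lemma poles_subset: "poles u \<subseteq> V"
  using poles_deficient deficient_subset by blast

lemma finite_poles [simp]: "finite (poles u)"
  using finite_subset[OF poles_subset fin] .

lemma card_deficient_busy: "card (deficient \<union> busy) \<le> 2 * K\<^sup>2"
  using card_Un_le[of deficient busy] card_deficient card_busy K_le by linarith

text \<open>There is a gap between the threshold and \<open>q - 3 * K\<close>: a \<open>z\<close>
  outside the exceptional sets has only one deficient point, so the pole that
  \<open>exists_pole\<close> finds through it is \<open>p\<close>.\<close>

lemma pole_large:
  assumes "p \<in> poles u"
  shows "q \<le> card (line p \<inter> missed u) + 3 * K"
proof -
  have up: "u \<in> deficient" "p \<in> deficient" "2 * K\<^sup>2 < card (line p \<inter> missed u)"
    using assms by (auto simp: poles_def split: if_splits)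
  have "\<not> line p \<inter> missed u \<subseteq> deficient \<union> busy"
    using up(3) card_deficient_busy card_mono[of "deficient \<union> busy" "line p \<inter> missed u"] by auto
  then obtain z where z: "z \<in> line p" "z \<in> missed u" "z \<notin> deficient" "z \<notin> busy" by auto
  obtain p' where p': "line z \<inter> deficient = {p'}" "q \<le> card (line p' \<inter> missed u) + 3 * K"
    using exists_pole[OF up(1) z(2-4)] .
  have "p \<in> line z" using line_sym z(1) up(2) deficient_subset by auto
  then show ?thesis using p' up(2) by auto
qed

lemma pole_notin_line:
  assumes "p \<in> poles u" shows "p \<notin> line u"
proof
  assume p: "p \<in> line u"
  have "0 < card (line p \<inter> missed u)" using assms by (auto simp: poles_def split: if_splits)
  then obtain z where z: "z \<in> line p" "z \<in> missed u" by (auto simp: card_gt_0_iff)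
  have "p \<in> line z" using line_sym z(1) poles_subset assms by blast
  then show False using p z by (auto simp: missed_def)
qed

text \<open>The projection compares the two counts; they differ by
  \<open>defect u - defect p\<close>, which the gap in \<open>pole_large\<close> absorbs. This makes
  the completed relation symmetric.\<close>

lemma poles_sym:
  assumes "p \<in> poles u" shows "u \<in> poles p"
proof -
  have d: "u \<in> deficient" "p \<in> deficient" using poles_deficient[OF assms] by auto
  then have V: "u \<in> V" "p \<in> V" using deficient_subset by auto
  have "int q \<le> int (card (line u \<inter> missed p)) + 4 * int K"
    using card_line_missed[OF V pole_notin_line[OF assms]] pole_large[OF assms]
      defect_le[OF V(1)] defect_nonneg[OF V(2)] by linarith
  then have "2 * K\<^sup>2 < card (line u \<inter> missed p)" using K_le K_pos q_large by linarith
  then show ?thesis using d by (simp add: poles_def)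
qed

lemma missed_on_pole:
  assumes "u \<in> deficient" "z \<in> missed u" "z \<notin> deficient" "z \<notin> busy"
  obtains p where "p \<in> poles u" "z \<in> line p"
proof -
  obtain p where p: "line z \<inter> deficient = {p}" "q \<le> card (line p \<inter> missed u) + 3 * K"
    using exists_pole[OF assms] .
  have "2 * K\<^sup>2 < card (line p \<inter> missed u)" using p(2) K_le K_pos q_large by linarith
  moreover have "z \<in> V" using assms missed_subset by auto
  then have "z \<in> line p" using p line_sym by auto
  ultimately show ?thesis using that[of p] p assms by (auto simp: poles_def)
qed

text \<open>Up to \<open>O(K^2)\<close> elements, \<open>missed u\<close> is the union of the lines
  of the poles, which have about \<open>q\<close> elements each and overlap little, and its size is
  about \<open>q * defect u\<close>. The errors are smaller than \<open>q\<close>, so the two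
  integers agree.\<close>

lemma card_poles:
  assumes u: "u \<in> V"
  shows "int (card (poles u)) = defect u"
proof (cases "u \<in> deficient")
  case False
  then show ?thesis using u defect_nonneg[OF u] by (simp add: poles_def deficient_def)
next
  case True
  let ?c = "int (card (poles u))"
  have cl: "card (line p) \<le> q + 1" if "p \<in> V" for p
    using defect_nonneg[OF that] by (simp add: defect_def)
  have "card (missed u) \<le> card ((deficient \<union> busy) \<union> (\<Union>p\<in>poles u. line p))"
    by (rule card_mono) (use missed_on_pole[OF True] in auto)
  also have "\<dots> \<le> 2 * K\<^sup>2 + (\<Sum>p\<in>poles u. card (line p))"
    by (rule order_trans[OF card_Un_le add_mono[OF card_deficient_busy card_UN_le]]) simp
  also have "(\<Sum>p\<in>poles u. card (line p)) \<le> (\<Sum>p\<in>poles u. q + 1)"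
    by (rule sum_mono) (use cl poles_subset in auto)
  finally have "card (missed u) \<le> 2 * K\<^sup>2 + card (poles u) * (q + 1)" by simp
  then have "int (card (missed u)) \<le> int (2 * K\<^sup>2 + card (poles u) * (q + 1))" by (rule of_nat_mono)
  then have "int (card (missed u)) \<le> 2 * int (K\<^sup>2) + ?c * (int q + 1)"
    by (simp only: of_nat_add of_nat_mult of_nat_numeral of_nat_1)
  moreover have "0 \<le> (\<Sum>w\<in>line u. defect w)" using line_subset by (intro sum_nonneg defect_nonneg) auto
  ultimately have 1: "int q * defect u \<le> 2 * int (K\<^sup>2) + ?c * (int q + 1)"
    using card_missed[OF u] by linarith
  have "card (poles u) \<le> K"
    using card_mono[of deficient "poles u"] poles_deficient card_deficient by fastforce
  then have cK: "card (poles u) * card (poles u) \<le> K\<^sup>2" "card (poles u) * K \<le> K\<^sup>2"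
    unfolding power2_eq_square by (auto intro: mult_le_mono)
  have "card (poles u) * q = (\<Sum>p\<in>poles u. q)" by simp
  also have "\<dots> \<le> (\<Sum>p\<in>poles u. card (line p \<inter> missed u) + 3 * K)"
    by (rule sum_mono) (rule pole_large)
  also have "\<dots> = (\<Sum>p\<in>poles u. card (line p \<inter> missed u)) + 3 * (card (poles u) * K)"
    by (simp add: sum.distrib)
  also have "\<dots> \<le> card (missed u) + (card (poles u))\<^sup>2 + 3 * (card (poles u) * K)"
    using sum_line_Int_le[OF poles_subset missed_subset] sum_excess_0 by simp
  finally have "card (poles u) * q \<le> card (missed u) + 4 * K\<^sup>2"
    using cK unfolding power2_eq_square by linarith
  then have "int (card (poles u) * q) \<le> int (card (missed u) + 4 * K\<^sup>2)" by (rule of_nat_mono)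
  then have "?c * int q \<le> int (card (missed u)) + 4 * int (K\<^sup>2)"
    by (simp only: of_nat_add of_nat_mult of_nat_numeral)
  then have 2: "?c * int q \<le> int q * defect u + 5 * int (K\<^sup>2)"
    using card_missed[OF u] sum_defect_le[OF line_subset, of u] K_le by linarith
  show ?thesis
  proof (rule linorder_cases)
    assume "?c < defect u"
    then have "?c * (int q + 1) \<le> (defect u - 1) * (int q + 1)" by (intro mult_right_mono) auto
    then have "int q \<le> 2 * int (K\<^sup>2) + defect u" using 1 by (simp add: algebra_simps)
    then show ?thesis using defect_le[OF u] K_le K_pos q_large by linarith
  next
    assume "defect u < ?c"
    then have "(defect u + 1) * int q \<le> ?c * int q" by (intro mult_right_mono) auto
    then have "int q \<le> 5 * int (K\<^sup>2)" using 2 by (simp add: algebra_simps)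
    then show ?thesis using K_le K_pos q_large by linarith
  qed
qed

text \<open>Adding all flags \<open>(u, p)\<close> with \<open>p \<in> poles u\<close> removes every defect. Pairs of lines with two
  common points could now only occur inside the small set \<open>T\<close> below, and then
  \<open>double_meet_missed\<close> excludes them.\<close>

lemma completion:
  obtains R' where "sym_structure V R' q" "\<forall>v\<in>V. sym_structure.defect V R' q v = 0"
    "\<forall>u\<in>V. \<forall>v\<in>V. u \<noteq> v \<longrightarrow> sym_structure.meet V R' u v = 1"
    "card {(u, v) \<in> V \<times> V. R' u v \<and> \<not> R u v} \<le> K"
proof -
  define R' where "R' = (\<lambda>u v. R u v \<or> v \<in> poles u)"
  interpret S: sym_structure V R' q
    by standard (use fin card_V sym poles_sym in \<open>auto simp: R'_def\<close>)
  have lineS: "S.line v = line v \<union> poles v" for v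
    unfolding S.line_def line_def using poles_subset by (auto simp: R'_def)
  have defS: "S.defect v = 0" if v: "v \<in> V" for v
  proof -
    have "card (S.line v) = card (line v) + card (poles v)"
      unfolding lineS using pole_notin_line by (intro card_Un_disjoint) auto
    then show ?thesis using card_poles[OF v] by (simp add: S.defect_def defect_def)
  qed
  \<comment> \<open>The last part holds the lines through an added point \<open>p\<close> of
    \<open>line u\<close> that met \<open>line u\<close> already; they now have a second common
    point with it.\<close>
  define T where "T = deficient \<union> busy \<union> (\<Union>u\<in>deficient. \<Union>p\<in>poles u. line p - missed u)"
  have finT: "finite T" by (simp add: T_def)
  have cardT: "card T \<le> 6 * K\<^sup>2"
  proof -
    have "card (line p - missed u) \<le> 4 * K" if p: "p \<in> poles u" for p u
    proof -
      have "card (line p) = card (line p \<inter> missed u) + card (line p - missed u)"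
        by (simp add: card_Int_Diff)
      moreover have "p \<in> V" using p poles_subset by auto
      then have "card (line p) \<le> q + 1" using defect_nonneg[of p] by (simp add: defect_def)
      ultimately show ?thesis using pole_large[OF p] K_pos by linarith
    qed
    then have "(\<Sum>u\<in>deficient. \<Sum>p\<in>poles u. card (line p - missed u)) \<le> (\<Sum>u\<in>deficient. \<Sum>p\<in>poles u. 4 * K)"
      by (intro sum_mono) auto
    also have "\<dots> = 4 * K * (\<Sum>u\<in>deficient. card (poles u))"
      by (simp add: sum_distrib_left mult.commute)
    also have "(\<Sum>u\<in>deficient. card (poles u)) \<le> K"
    proof -
      have "int (\<Sum>u\<in>deficient. card (poles u)) = (\<Sum>u\<in>deficient. defect u)"
        using card_poles deficient_subset by (simp add: subset_iff)
      then show ?thesis using sum_defect_le[OF deficient_subset] by linarith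
    qed
    finally have "(\<Sum>u\<in>deficient. \<Sum>p\<in>poles u. card (line p - missed u)) \<le> 4 * K\<^sup>2"
      by (simp add: power2_eq_square)
    moreover have "card (\<Union>u\<in>deficient. \<Union>p\<in>poles u. line p - missed u)
        \<le> (\<Sum>u\<in>deficient. \<Sum>p\<in>poles u. card (line p - missed u))"
      by (rule order_trans[OF card_UN_le sum_mono[OF card_UN_le]]) auto
    ultimately show ?thesis unfolding T_def
      using card_deficient_busy card_Un_le[of "deficient \<union> busy" "\<Union>u\<in>deficient. \<Union>p\<in>poles u. line p - missed u"]
      by linarith
  qed
  have conflict: "u \<in> T"
    if V: "u \<in> V" "b \<in> V" and ub: "u \<noteq> b" and p: "p \<noteq> p'" "p \<in> S.line u \<inter> S.line b" "p' \<in> S.line u \<inter> S.line b"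
    for u b p p'
  proof (rule ccontr)
    assume nT: "u \<notin> T"
    have nd: "u \<notin> deficient" "u \<notin> busy" using nT by (auto simp: T_def)
    then have "poles u = {}" using poles_deficient by blast
    then have old: "p \<in> line u" "p' \<in> line u" using p by (auto simp: lineS)
    have no: False if c: "c \<noteq> c'" "c \<in> line u" "c' \<in> line u" "c \<in> poles b" "c' \<in> S.line b" for c c'
    proof -
      have "c' \<notin> deficient"
      proof
        assume "c' \<in> deficient"
        then have "{c, c'} \<subseteq> line u \<inter> deficient" using c poles_deficient by auto
        then have "card {c, c'} \<le> card (line u \<inter> deficient)" by (intro card_mono) auto
        then show False using nd(2) V c by (simp add: busy_def)
      qed
      then have "c' \<in> line b" using c(5) poles_deficient by (auto simp: lineS)
      then have "u \<notin> missed b" using c by (auto simp: missed_def)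
      moreover have "u \<in> line c" using line_sym[OF V(1) c(2)] .
      moreover have "b \<in> deficient" using c poles_deficient by auto
      ultimately show False using nT c(4) by (auto simp: T_def)
    qed
    have "p \<in> line b \<or> p \<in> poles b" "p' \<in> line b \<or> p' \<in> poles b" using p by (auto simp: lineS)
    then show False
      using no[of p p'] no[of p' p] old p line_meet_unique[OF V ub, of p p'] by auto
  qed
  have exS: "S.excess y = 0" if y: "y \<in> V - T" for y
  proof -
    have "S.meet u y \<le> 1" if u: "u \<in> V - {y}" for u
    proof (rule ccontr)
      assume "\<not> ?thesis"
      then obtain p p' where "p \<noteq> p'" "p \<in> S.line u \<inter> S.line y" "p' \<in> S.line u \<inter> S.line y"
        using S.pair_in_meet[of u y] by auto
      then show False using conflict[of y u p p'] u y by auto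
    qed
    then show ?thesis by (simp add: S.excess_def)
  qed
  have missS: "card (S.missed u) \<le> 2 * K\<^sup>2" if u: "u \<in> V" for u
  proof (cases "u \<in> deficient")
    case True
    have "S.missed u \<subseteq> deficient \<union> busy"
    proof
      fix z assume z: "z \<in> S.missed u"
      then have zm: "z \<in> missed u" by (auto simp: S.missed_def missed_def lineS)
      show "z \<in> deficient \<union> busy"
      proof (rule ccontr)
        assume "\<not> ?thesis"
        then obtain p where p: "p \<in> poles u" "z \<in> line p" using missed_on_pole[OF True zm] by auto
        then have "p \<in> line z" using line_sym poles_subset by blast
        then show False using z p by (auto simp: S.missed_def lineS)
      qed
    qed
    then have "card (S.missed u) \<le> card (deficient \<union> busy)" by (intro card_mono) auto
    then show ?thesis using card_deficient_busy by simp
  next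
    case False
    have "card (S.missed u) \<le> card (missed u)"
      by (rule card_mono[OF finite_missed]) (auto simp: S.missed_def missed_def lineS)
    moreover have "defect u = 0" using False u defect_nonneg[OF u] by (simp add: deficient_def)
    ultimately show ?thesis using card_missed[OF u] sum_defect_le[OF line_subset, of u] K_le by simp
  qed
  have le1: "S.meet u b \<le> 1" if ub: "u \<in> V" "b \<in> V" "u \<noteq> b" for u b
  proof (rule ccontr)
    assume "\<not> ?thesis"
    then obtain p p' where p: "p \<noteq> p'" "p \<in> S.line u \<inter> S.line b" "p' \<in> S.line u \<inter> S.line b"
      using S.pair_in_meet[of u b] by auto
    have "q + 1 \<le> card (S.missed u) + S.meet u b + card (S.line b \<inter> T)"
      by (rule S.double_meet_missed[OF ub defS defS p]) (use ub exS defS in auto)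
    moreover have "card (S.line b \<inter> T) \<le> card T" using finT by (intro card_mono) auto
    \<comment> \<open>By symmetry, two common points of \<open>line u\<close> and
      \<open>line b\<close> are themselves lines with the common points \<open>u\<close> and
      \<open>b\<close>, so \<open>conflict\<close> puts them into \<open>T\<close> as well.\<close>
    moreover have "S.meet u b \<le> card T" unfolding S.meet_def
    proof (rule card_mono[OF finT], rule subsetI)
      fix c assume c: "c \<in> S.line u \<inter> S.line b"
      obtain c' where c': "c' \<noteq> c" "c' \<in> S.line u \<inter> S.line b" using p by metis
      have "c \<in> V" "c' \<in> V" using c c' S.line_subset by auto
      moreover have "u \<in> S.line c \<inter> S.line c'" "b \<in> S.line c \<inter> S.line c'"
        using c c' S.line_sym[OF ub(1)] S.line_sym[OF ub(2)] by auto
      ultimately show "c \<in> T" using conflict[of c c' u b] ub(3) c'(1) by auto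
    qed
    ultimately show False using missS[OF ub(1)] cardT q_large K_le K_pos by linarith
  qed
  have eq1: "S.meet u b = 1" if ub: "u \<in> V" "b \<in> V" "u \<noteq> b" for u b
  proof -
    have "S.excess b = 0" using le1 ub by (auto simp: S.excess_def)
    moreover have "(\<Sum>w\<in>S.line b. S.defect w) = 0" using defS S.line_subset by (intro sum.neutral) auto
    ultimately have "card (S.missed b) = 0" using S.missed_minus_excess[OF ub(2)] defS[OF ub(2)] by simp
    then have "u \<notin> S.missed b" by auto
    then have "S.meet u b \<noteq> 0" using ub by (auto simp: S.missed_def S.meet_def)
    then show ?thesis using le1[OF ub] by simp
  qed
  have added: "card {(u, v) \<in> V \<times> V. R' u v \<and> \<not> R u v} \<le> K"
  proof -
    have "{(u, v) \<in> V \<times> V. R' u v \<and> \<not> R u v} = Sigma V poles"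
      using pole_notin_line poles_subset by (fastforce simp: R'_def line_def)
    then have "int (card {(u, v) \<in> V \<times> V. R' u v \<and> \<not> R u v}) = (\<Sum>u\<in>V. int (card (poles u)))"
      using fin by simp
    also have "\<dots> = (\<Sum>u\<in>V. defect u)" using card_poles by simp
    also have "\<dots> \<le> int K" by (rule sum_defect_le) simp
    finally show ?thesis by simp
  qed
  show ?thesis
    by (rule that[OF S.sym_structure_axioms _ _ added]) (use defS eq1 in blast)+
qed

end

section \<open>Dense graphs with few quadrilaterals\<close>

text \<open>The sum \<open>q + 1\<close> would arise from one missing neighbour at each of the
  \<open>q + 1\<close> absolute points of an orthogonal polarity. Additional edges lower it, and
  \<open>m\<close> is a multiple of \<open>t + 1\<close> that bounds this loss and the excess per
  \<open>q\<close>.\<close>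

locale dense_structure = sym_structure +
  fixes m :: nat
  assumes irrefl: "\<not> R v v"
    and even_q: "even q"
    and m_pos: "1 \<le> m"
    and sum_defect_le: "(\<Sum>v\<in>V. defect v) \<le> int q + 1"
    and sum_defect_ge: "int q + 1 - int m \<le> (\<Sum>v\<in>V. defect v)"
    and sum_excess_le: "(\<Sum>v\<in>V. excess v) \<le> m * q"
    and q_large: "10000000000 * m\<^sup>2 \<le> q"
begin

section \<open>First bounds on the degrees\<close>

definition over :: "'a set" where
  "over = {v \<in> V. defect v < 0}"

definition under :: "'a set" where
  "under = {v \<in> V. 0 < defect v}"

definition surplus :: int where
  "surplus = (\<Sum>v\<in>over. - defect v)"

definition deficit :: int where
  "deficit = (\<Sum>v\<in>under. defect v)"

lemma m_le: "10000000000 * int m \<le> int q" "1 \<le> int m"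
proof -
  have "m * 1 \<le> m * m" using m_pos by (intro mult_left_mono) auto
  then show "10000000000 * int m \<le> int q" "1 \<le> int m"
    using q_large m_pos unfolding power2_eq_square by linarith+
qed

lemma m_le_mq: "int m \<le> int m * int q" "10000000000 * (int m * int q) \<le> int q * int q" "int q \<le> int m * int q"
  using m_le mult_right_mono[OF m_le(1), of "int q"] mult_left_mono[of 1 "int q" "int m"]
    mult_right_mono[of 1 "int m" "int q"] by auto

lemma over_subset: "over \<subseteq> V" and under_subset: "under \<subseteq> V"
  by (auto simp: over_def under_def)

lemma finite_over [simp]: "finite over" and finite_under [simp]: "finite under"
  using finite_subset[OF over_subset fin] finite_subset[OF under_subset fin] .

lemma over_under_disjoint: "over \<inter> under = {}"
  by (auto simp: over_def under_def)

lemma sum_under_minus_over: "(\<Sum>v\<in>V. defect v) = deficit - surplus"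
proof -
  have "(\<Sum>v\<in>V. defect v) = (\<Sum>v\<in>over \<union> under. defect v)"
    by (rule sum.mono_neutral_right[OF fin]) (auto simp: over_def under_def)
  also have "\<dots> = (\<Sum>v\<in>over. defect v) + (\<Sum>v\<in>under. defect v)"
    by (rule sum.union_disjoint) (auto simp: over_under_disjoint)
  finally show ?thesis by (simp add: deficit_def surplus_def sum_negf)
qed

lemma card_over_le: "int (card over) \<le> surplus"
proof -
  have "int (card over) = (\<Sum>v\<in>over. 1)" by simp
  also have "\<dots> \<le> surplus" unfolding surplus_def by (rule sum_mono) (auto simp: over_def)
  finally show ?thesis .
qed

lemma card_under_le: "int (card under) \<le> deficit"
proof -
  have "int (card under) = (\<Sum>v\<in>under. 1)" by simp
  also have "\<dots> \<le> deficit" unfolding deficit_def by (rule sum_mono) (auto simp: under_def)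
  finally show ?thesis .
qed

lemma excess_le: "v \<in> V \<Longrightarrow> int (excess v) \<le> int m * int q"
  using member_le_sum[of v V excess] fin sum_excess_le by (simp flip: of_nat_mult)

lemma sum_excess_le_int: "A \<subseteq> V \<Longrightarrow> (\<Sum>v\<in>A. int (excess v)) \<le> int m * int q"
  using sum_mono2[OF fin, of A excess] sum_excess_le by (simp flip: of_nat_mult of_nat_sum)

lemma sum_line_defect_le:
  "(\<Sum>w\<in>line v. defect w) \<le> (\<Sum>w\<in>line v \<inter> under. defect w)"
  "(\<Sum>w\<in>line v \<inter> under. defect w) \<le> deficit"
proof -
  have "(\<Sum>w\<in>line v. defect w) = (\<Sum>w\<in>line v \<inter> under. defect w) + (\<Sum>w\<in>line v - under. defect w)"
    by (rule sum.Int_Diff) simp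
  moreover have "(\<Sum>w\<in>line v - under. defect w) \<le> 0"
    by (rule sum_nonpos) (use line_subset in \<open>auto simp: under_def not_less\<close>)
  ultimately show "(\<Sum>w\<in>line v. defect w) \<le> (\<Sum>w\<in>line v \<inter> under. defect w)" by simp
  show "(\<Sum>w\<in>line v \<inter> under. defect w) \<le> deficit" unfolding deficit_def
    by (rule sum_mono2[OF finite_under]) (auto simp: under_def)
qed

text \<open>In the sum of \<open>missed_minus_excess\<close> over all \<open>v\<close>, the defect
  of \<open>w\<close> is counted once for each of its \<open>q + 1 - defect w\<close> neighbours,
  whence the square.\<close>

lemma sum_missed:
  "(\<Sum>v\<in>V. int (card (missed v))) =
   (\<Sum>v\<in>V. int (excess v)) + (2 * int q + 1) * (\<Sum>v\<in>V. defect v) - (\<Sum>v\<in>V. (defect v)\<^sup>2)"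
proof -
  have "(\<Sum>v\<in>V. int (card (missed v)) - int (excess v)) = (\<Sum>v\<in>V. int q * defect v + (\<Sum>w\<in>line v. defect w))"
    by (rule sum.cong[OF refl missed_minus_excess])
  also have "\<dots> = int q * (\<Sum>v\<in>V. defect v) + (\<Sum>v\<in>V. int (card (line v)) * defect v)"
    using sum_weight_swap[OF subset_refl, of defect] by (simp add: sum.distrib sum_distrib_left)
  also have "(\<Sum>v\<in>V. int (card (line v)) * defect v) = (\<Sum>v\<in>V. (int q + 1) * defect v - (defect v)\<^sup>2)"
    by (rule sum.cong[OF refl]) (simp add: defect_def power2_eq_square algebra_simps)
  also have "\<dots> = (int q + 1) * (\<Sum>v\<in>V. defect v) - (\<Sum>v\<in>V. (defect v)\<^sup>2)"
    by (simp add: sum_subtractf sum_distrib_left)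
  finally show ?thesis by (simp add: sum_subtractf algebra_simps)
qed

text \<open>This is the budget on which \<open>deficit_le_101\<close> and
  \<open>card_not_tame\<close> draw; the squares make the Cauchy-Schwarz estimate in
  \<open>surplus_le_10q\<close> possible.\<close>

lemma sum_missed_le:
  "(\<Sum>v\<in>V. int (card (missed v))) + (\<Sum>v\<in>V. (defect v)\<^sup>2) \<le> 2 * (int q * int q) + 5 * (int m * int q)"
proof -
  have "(2 * int q + 1) * (\<Sum>v\<in>V. defect v) \<le> (2 * int q + 1) * (int q + 1)"
    using sum_defect_le by (intro mult_left_mono) auto
  also have "\<dots> = 2 * (int q * int q) + 3 * int q + 1" by (simp add: algebra_simps)
  finally show ?thesis using sum_missed sum_excess_le_int[OF subset_refl] m_le_mq m_le by linarith
qed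

lemma sum_defect_square_le: "(\<Sum>v\<in>V. (defect v)\<^sup>2) \<le> 3 * (int q * int q)"
proof -
  have "0 \<le> (\<Sum>v\<in>V. int (card (missed v)))" by (intro sum_nonneg) auto
  then show ?thesis using sum_missed_le m_le_mq m_le by linarith
qed

lemma surplus_bounds:
  assumes "v \<in> over"
  shows "int q * (- defect v) \<le> (\<Sum>w\<in>line v. defect w) + int (excess v)"
proof -
  have "v \<in> V" using assms over_subset by auto
  then have "int q * defect v + (\<Sum>w\<in>line v. defect w) + int (excess v) = int (card (missed v))"
    using missed_minus_excess by fastforce
  then have "0 \<le> int q * defect v + (\<Sum>w\<in>line v. defect w) + int (excess v)" by simp
  then show ?thesis by simp
qed

text \<open>By \<open>surplus_bounds\<close>, vertices of too large degree see many vertices of too small degree. The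
  defects sum to about \<open>q\<close>, so this is a deviation from the mean, which Cauchy-Schwarz limits.\<close>

lemma surplus_le_10q: "surplus \<le> 10 * int q"
proof (rule ccontr)
  define a where "a = int (card over)"
  define e where "e = (\<lambda>u. int (card (line u \<inter> over)))"
  define Y where "Y = (\<Sum>u\<in>V. e u * defect u)"
  define d where "d = (\<Sum>v\<in>over. int (card (line v)))"
  define s where "s = (\<Sum>v\<in>V. defect v)"
  assume "\<not> ?thesis"
  then have N: "10 * int q < surplus" by simp
  have q1: "1 \<le> int q" using m_le by linarith
  have a: "0 \<le> a" "a \<le> surplus" using card_over_le by (auto simp: a_def)
  have s: "0 \<le> s" "s \<le> int q + 1" using sum_defect_le sum_defect_ge m_le by (auto simp: s_def)
  have d: "d = (int q + 1) * a + surplus"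
    by (simp add: d_def a_def surplus_def defect_def sum_subtractf sum_negf algebra_simps)
  have Y: "int q * surplus - int m * int q \<le> Y"
  proof -
    have "int q * surplus = (\<Sum>v\<in>over. int q * (- defect v))"
      by (simp add: surplus_def sum_distrib_left)
    also have "\<dots> \<le> (\<Sum>v\<in>over. (\<Sum>w\<in>line v. defect w) + int (excess v))"
      by (rule sum_mono) (rule surplus_bounds)
    also have "\<dots> = Y + (\<Sum>v\<in>over. int (excess v))"
      using sum_weight_swap[OF over_subset, of defect] by (simp add: sum.distrib Y_def e_def)
    finally show ?thesis using sum_excess_le_int[OF over_subset] by linarith
  qed
  have sum_e: "(\<Sum>u\<in>V. e u) = d"
    using sum_card_swap[OF subset_refl over_subset] by (simp add: e_def d_def flip: of_nat_sum)
  have sum_e2: "(\<Sum>u\<in>V. (e u)\<^sup>2) \<le> d + a\<^sup>2 + int m * int q"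
  proof -
    have "int (\<Sum>y\<in>V. (card (line y \<inter> over))\<^sup>2) \<le> int ((\<Sum>v\<in>over. card (line v)) + (card over)\<^sup>2 + m * q)"
      using sum_square_line[OF over_subset] sum_excess_le by linarith
    then show ?thesis by (simp add: e_def d_def a_def)
  qed
  \<comment> \<open>The mean of \<open>e\<close> is roughly \<open>a / q\<close>; the deviation is
    multiplied by \<open>q\<close> to stay within the integers.\<close>
  have centred: "(\<Sum>u\<in>V. (int q * e u - a)\<^sup>2) \<le> int q * int q * ((int q + 2) * surplus + int m * int q)"
  proof -
    have "(\<Sum>u\<in>V. (int q * e u - a)\<^sup>2) = (\<Sum>u\<in>V. int q * int q * (e u)\<^sup>2 - 2 * int q * a * e u + a\<^sup>2)"
      by (rule sum.cong) (simp_all add: power2_eq_square algebra_simps)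
    also have "\<dots> = int q * int q * (\<Sum>u\<in>V. (e u)\<^sup>2) - 2 * int q * a * d + a\<^sup>2 * int (card V)"
      by (simp add: sum.distrib sum_subtractf sum_distrib_left flip: sum_e)
    also have "\<dots> \<le> int q * int q * (d + a\<^sup>2 + int m * int q) - 2 * int q * a * d + a\<^sup>2 * int (card V)"
      using mult_left_mono[OF sum_e2, of "int q * int q"] by simp
    also have "\<dots> = int q * int q * (d + int m * int q) + (int q * int q + int (card V)) * a\<^sup>2 - 2 * int q * a * d"
      by (simp add: algebra_simps)
    also have "\<dots> \<le> int q * int q * (d + int m * int q)"
    proof -
      have "(int q * int q + int (card V)) * a\<^sup>2 - 2 * int q * a * d = - ((int q - 1) * a\<^sup>2) - 2 * int q * (a * surplus)"
        unfolding d card_V by (simp add: power2_eq_square algebra_simps)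
      also have "\<dots> \<le> 0"
      proof -
        have "0 \<le> (int q - 1) * a\<^sup>2" "0 \<le> 2 * int q * (a * surplus)" using a q1 by simp_all
        then show ?thesis by linarith
      qed
      finally show ?thesis by simp
    qed
    also have "\<dots> \<le> int q * int q * ((int q + 2) * surplus + int m * int q)"
    proof -
      have "(int q + 1) * a \<le> (int q + 1) * surplus" using a by (intro mult_left_mono) auto
      then have "d \<le> (int q + 2) * surplus" unfolding d by (simp add: algebra_simps)
      then show ?thesis by (intro mult_left_mono) auto
    qed
    finally show ?thesis .
  qed
  define Q where "Q = int q * int q"
  have Q: "1 \<le> Q" unfolding Q_def using mult_mono[OF q1 q1] by simp
  have "(\<Sum>u\<in>V. defect u * (int q * e u - a)) = int q * Y - a * s"
    by (simp add: Y_def s_def sum_subtractf sum_distrib_left algebra_simps)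
  then have CS: "(int q * Y - a * s)\<^sup>2 \<le> (\<Sum>v\<in>V. (defect v)\<^sup>2) * (\<Sum>u\<in>V. (int q * e u - a)\<^sup>2)"
    using Cauchy_Schwarz_int[of defect "\<lambda>u. int q * e u - a" V] by simp
  also have "\<dots> \<le> (3 * Q) * (Q * ((int q + 2) * surplus + int m * int q))"
    using sum_defect_square_le centred unfolding Q_def by (intro mult_mono) (auto intro: sum_nonneg)
  also have "\<dots> \<le> (3 * Q) * (Q * (2 * (int q * surplus)))"
  proof -
    have "int q * (int m + 20) \<le> int q * surplus" using N m_le by (intro mult_left_mono) auto
    moreover have "100 * surplus \<le> int q * surplus" using N m_le by (intro mult_right_mono) auto
    moreover have "int q * (2 * int m) \<le> int q * surplus" using N m_le by (intro mult_left_mono) auto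
    ultimately have "(int q + 2) * surplus + int m * int q \<le> 2 * (int q * surplus)"
      by (simp add: algebra_simps)
    then show ?thesis using Q by (intro mult_left_mono) auto
  qed
  finally have up: "(int q * Y - a * s)\<^sup>2 \<le> 6 * (Q * Q) * (int q * surplus)" by (simp add: algebra_simps)
  have pos: "0 \<le> Q * surplus" using Q a by auto
  \<comment> \<open>The main term \<open>q * Y\<close> is about \<open>q^2 * surplus\<close>, while
    \<open>a * s\<close> is at most about \<open>q * surplus\<close>, so nine tenths of the main
    term survive.\<close>
  have low: "9 * (Q * surplus) \<le> 10 * (int q * Y - a * s)"
  proof -
    have 1: "int q * (int q * surplus - int m * int q) \<le> int q * Y"
      using Y by (intro mult_left_mono) auto
    have 2: "a * s \<le> surplus * (int q + 1)" using a s by (intro mult_mono) auto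
    have 3: "Q * (20 * int m) \<le> Q * surplus" using Q N m_le by (intro mult_left_mono) auto
    have "40 * (int q + 1) \<le> int q * int q"
    proof -
      have "41 * int q \<le> int q * int q" using m_le by (intro mult_right_mono) auto
      moreover have "40 * (int q + 1) \<le> 41 * int q" using m_le by simp
      ultimately show ?thesis by (rule order_trans[rotated])
    qed
    then have 4: "surplus * (40 * (int q + 1)) \<le> surplus * Q"
      unfolding Q_def using a by (intro mult_left_mono) auto
    have 5: "int q * (int q * surplus - int m * int q) = Q * surplus - Q * int m"
      "surplus * (40 * (int q + 1)) = 40 * (surplus * (int q + 1))"
      "Q * (20 * int m) = 20 * (Q * int m)" "surplus * Q = Q * surplus"
      by (simp_all add: Q_def algebra_simps)
    have "9 * (Q * surplus) \<le> 10 * (int q * Y) - 10 * (a * s)"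
      using 1 2 3 4 pos unfolding 5 by linarith
    then show ?thesis by (simp only: right_diff_distrib)
  qed
  have "(9 * (Q * surplus)) * (9 * (Q * surplus)) \<le> (10 * (int q * Y - a * s)) * (10 * (int q * Y - a * s))"
  proof (rule mult_mono[OF low low])
    show "0 \<le> 9 * (Q * surplus)" using pos by simp
    then show "0 \<le> 10 * (int q * Y - a * s)" using low by (rule order_trans)
  qed
  also have "\<dots> = 100 * (int q * Y - a * s)\<^sup>2" by (simp add: power2_eq_square algebra_simps)
  also have "\<dots> \<le> 100 * (6 * (Q * Q) * (int q * surplus))" using up by linarith
  finally have "(Q * Q * surplus) * (81 * surplus) \<le> (Q * Q * surplus) * (600 * int q)"
    by (simp add: algebra_simps)
  moreover have "0 < Q * Q * surplus" using Q N q1 by (auto intro!: mult_pos_pos)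
  ultimately have "81 * surplus \<le> 600 * int q" by (simp only: mult_le_cancel_left_pos)
  then show False using N q1 by linarith
qed

lemma deficit_le_12q: "deficit \<le> 12 * int q"
  using surplus_le_10q sum_under_minus_over sum_defect_le m_le by linarith

lemma neg_defect_le:
  assumes "v \<in> over"
  shows "- defect v \<le> 13 * int m"
proof -
  have "int q * (- defect v) \<le> 12 * int q + int m * int q"
    using surplus_bounds[OF assms] sum_line_defect_le[of v] deficit_le_12q excess_le[of v] assms over_subset
    by (meson add_mono order_trans subsetD)
  also have "\<dots> = int q * (12 + int m)" by (simp add: algebra_simps)
  finally have "int q * (- defect v) \<le> int q * (12 + int m)" .
  moreover have "0 < int q" using m_le by linarith
  ultimately have "- defect v \<le> 12 + int m" by (simp only: mult_le_cancel_left_pos)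
  then show ?thesis using m_le by linarith
qed


section \<open>Sharp bounds on the degrees by the parity argument\<close>

definition regular :: "'a set" where
  "regular = {v \<in> V. defect v = 0 \<and> excess v = 0}"

text \<open>One is the least number possible for a regular vertex; the missed vertex is then the
  neighbour from \<open>missed_neighbour\<close>.\<close>

definition tame :: "'a set" where
  "tame = {v \<in> regular. card (missed v) = 1}"

lemma regular_subset: "regular \<subseteq> V" and tame_subset: "tame \<subseteq> V"
  by (auto simp: tame_def regular_def)

lemma finite_regular [simp]: "finite regular"
  using finite_subset[OF regular_subset fin] .

text \<open>Otherwise the common neighbour with \<open>v\<close> would pair off the \<open>q + 1\<close> neighbours of \<open>v\<close>.\<close>

lemma missed_neighbour:
  assumes v: "v \<in> regular"
  obtains y where "y \<in> line v" "y \<in> missed v"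
proof -
  have V: "v \<in> V" and ex: "excess v = 0" and def0: "defect v = 0" using v by (auto simp: regular_def)
  have "\<exists>y\<in>line v. y \<in> missed v"
  proof (rule ccontr)
    assume neg: "\<not> ?thesis"
    have neq: "y \<in> V" "y \<noteq> v" if "y \<in> line v" for y
      using that irrefl by (auto simp: line_def)
    have "\<exists>p. p \<in> line y \<inter> line v" if "y \<in> line v" for y
      using neg neq[OF that] that by (auto simp: missed_def)
    then obtain h where h: "\<And>y. y \<in> line v \<Longrightarrow> h y \<in> line y \<inter> line v" by metis
    have uniq: "p = p'" if "y \<in> line v" "p \<in> line y \<inter> line v" "p' \<in> line y \<inter> line v" for y p p'
    proof -
      have "card {p, p'} \<le> meet y v" unfolding meet_def using that by (intro card_mono) auto
      also have "\<dots> \<le> 1" using meet_le_Suc_excess[of y v] neq[OF that(1)] ex by simp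
      finally show ?thesis by (cases "p = p'") auto
    qed
    have "\<exists>y\<in>line v. h y = y"
    proof (rule involution_fixed_point)
      have "card (line v) = q + 1" using def0 by (simp add: defect_def)
      then show "odd (card (line v))" using even_q by simp
      show hv: "h y \<in> line v" if "y \<in> line v" for y using h[OF that] by auto
      show "h (h y) = y" if y: "y \<in> line v" for y
      proof (rule uniq[OF hv[OF y]])
        show "h (h y) \<in> line (h y) \<inter> line v" using h[OF hv[OF y]] .
        show "y \<in> line (h y) \<inter> line v" using h[OF y] y line_sym[of y "h y"] neq[OF y] by auto
      qed
    qed
    then obtain y where "y \<in> line v" "h y = y" by auto
    then have "y \<in> line y" using h[of y] by auto
    then show False using irrefl by (auto simp: line_def)
  qed
  then show ?thesis using that by auto
qed

lemma card_missed_regular: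
  assumes "v \<in> regular" shows "1 \<le> card (missed v)"
proof -
  obtain y where "y \<in> missed v" using missed_neighbour[OF assms] .
  then have "0 < card (missed v)" by (auto simp: card_gt_0_iff)
  then show ?thesis by simp
qed

lemma sum_defect_regular:
  "v \<in> regular \<Longrightarrow> (\<Sum>w\<in>line v. defect w) = int (card (missed v))"
  using missed_minus_excess[of v] by (simp add: regular_def)

lemma card_not_regular: "int (card (V - regular)) \<le> 23 * (int m * int q)"
proof -
  define D where "D = {v \<in> V. 0 < excess v}"
  have "int (card D) = (\<Sum>v\<in>D. 1)" by simp
  also have "\<dots> \<le> (\<Sum>v\<in>D. int (excess v))" by (rule sum_mono) (auto simp: D_def)
  also have "\<dots> \<le> int m * int q" by (rule sum_excess_le_int) (auto simp: D_def)
  finally have D: "int (card D) \<le> int m * int q" .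
  have "card (V - regular) \<le> card (over \<union> (under \<union> D))"
    using fin by (intro card_mono) (auto simp: regular_def over_def under_def D_def)
  also have "\<dots> \<le> card over + (card under + card D)"
    using card_Un_le[of under D] card_Un_le[of over "under \<union> D"] by linarith
  finally show ?thesis
    using D card_over_le card_under_le surplus_le_10q deficit_le_12q m_le_mq by linarith
qed

lemma card_regular: "int q * int q - 23 * (int m * int q) \<le> int (card regular)"
proof -
  have "int (card V) = int q * int q + int q + 1" by (simp add: card_V power2_eq_square)
  moreover have "card V = card regular + card (V - regular)"
    using card_Diff_subset[OF finite_regular regular_subset] card_mono[OF fin regular_subset] by simp
  ultimately show ?thesis using card_not_regular by linarith
qed

lemma sum_under_line_defect:
  "(\<Sum>v\<in>over. defect v * int (card (line v \<inter> under))) \<le> (\<Sum>v\<in>under. \<Sum>w\<in>line v. defect w)"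
proof -
  have "(\<Sum>v\<in>over. defect v * int (card (line v \<inter> under))) = (\<Sum>v\<in>over. int (card (line v \<inter> under)) * defect v)"
    by (simp add: mult.commute)
  also have "\<dots> \<le> (\<Sum>v\<in>over. int (card (line v \<inter> under)) * defect v) + (\<Sum>v\<in>V - over. int (card (line v \<inter> under)) * defect v)"
  proof -
    have "0 \<le> (\<Sum>v\<in>V - over. int (card (line v \<inter> under)) * defect v)"
      by (intro sum_nonneg mult_nonneg_nonneg) (auto simp: over_def not_less)
    then show ?thesis by simp
  qed
  also have "\<dots> = (\<Sum>v\<in>V. int (card (line v \<inter> under)) * defect v)"
    using sum.subset_diff[OF over_subset fin, of "\<lambda>v. int (card (line v \<inter> under)) * defect v"] by simp
  also have "\<dots> = (\<Sum>v\<in>under. \<Sum>w\<in>line v. defect w)"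
    using sum_weight_swap[OF under_subset, of defect] by simp
  finally show ?thesis .
qed

text \<open>The claim of \<open>under\<close> on the budget: each unit of defect produces
  \<open>q\<close> missed lines, up to what neighbours in \<open>over\<close> take back.\<close>

lemma sum_missed_under:
  "int q * deficit + (\<Sum>v\<in>over. defect v * int (card (line v \<inter> under))) \<le> (\<Sum>v\<in>under. int (card (missed v)))"
proof -
  have "int q * deficit + (\<Sum>v\<in>under. \<Sum>w\<in>line v. defect w) = (\<Sum>v\<in>under. int q * defect v + (\<Sum>w\<in>line v. defect w))"
    by (simp add: deficit_def sum.distrib sum_distrib_left)
  also have "\<dots> \<le> (\<Sum>v\<in>under. int (card (missed v)))"
  proof (rule sum_mono)
    fix v assume "v \<in> under"
    then have "v \<in> V" using under_subset by auto
    then show "int q * defect v + (\<Sum>w\<in>line v. defect w) \<le> int (card (missed v))"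
      using missed_minus_excess[of v] by simp
  qed
  finally show ?thesis using sum_under_line_defect by simp
qed

lemma sum_missed_under_regular:
  "(\<Sum>v\<in>under. int (card (missed v))) + (\<Sum>v\<in>regular. int (card (missed v)))
    \<le> 2 * (int q * int q) + 5 * (int m * int q)"
proof -
  have "(\<Sum>v\<in>under. int (card (missed v))) + (\<Sum>v\<in>regular. int (card (missed v)))
      = (\<Sum>v\<in>under \<union> regular. int (card (missed v)))"
    by (rule sum.union_disjoint[symmetric, OF finite_under finite_regular]) (auto simp: under_def regular_def)
  also have "\<dots> \<le> (\<Sum>v\<in>V. int (card (missed v)))"
    using under_subset regular_subset by (intro sum_mono2[OF fin]) auto
  also have "\<dots> \<le> (\<Sum>v\<in>V. int (card (missed v))) + (\<Sum>v\<in>V. (defect v)\<^sup>2)"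
    by (simp add: sum_nonneg)
  finally show ?thesis using sum_missed_le by linarith
qed

lemma card_line_under: "v \<in> under \<Longrightarrow> card (line v) \<le> q"
  by (simp add: under_def defect_def)

lemma sum_card_line_under: "(\<Sum>v\<in>under. card (line v)) \<le> q * card under"
  using sum_mono[of under "\<lambda>v. card (line v)" "\<lambda>_. q"] card_line_under by (simp add: mult.commute)

text \<open>Cauchy-Schwarz bounds the number of edges by \<open>40 * q^(3/2)\<close>. In
  \<open>deficit_le_101\<close> each of them weighs up to \<open>13 * m\<close>, so \<open>m\<close>
  times their number must be small compared with \<open>q^2\<close>; this is what the square of
  \<open>m\<close> in \<open>q_large\<close> is for.\<close>

lemma over_under_edges:
  "2000 * (int m * int (\<Sum>w\<in>over. card (line w \<inter> under))) \<le> int q * int q"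
proof -
  define e where "e = (\<Sum>w\<in>over. int (card (line w \<inter> under)))"
  have b: "int (card under) \<le> 12 * int q" using card_under_le deficit_le_12q by linarith
  have "e\<^sup>2 \<le> (\<Sum>w\<in>over. 1\<^sup>2) * (\<Sum>w\<in>over. (int (card (line w \<inter> under)))\<^sup>2)"
    using Cauchy_Schwarz_int[of "\<lambda>_. 1" "\<lambda>w. int (card (line w \<inter> under))" over] by (simp add: e_def)
  also have "\<dots> = int (card over) * (\<Sum>w\<in>over. (int (card (line w \<inter> under)))\<^sup>2)" by simp
  also have "\<dots> \<le> (10 * int q) * (160 * (int q * int q))"
  proof (rule mult_mono)
    show "int (card over) \<le> 10 * int q" using card_over_le surplus_le_10q by linarith
    have "(\<Sum>w\<in>over. (int (card (line w \<inter> under)))\<^sup>2) \<le> (\<Sum>w\<in>V. (int (card (line w \<inter> under)))\<^sup>2)"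
      using over_subset by (intro sum_mono2[OF fin]) auto
    also have "\<dots> = int (\<Sum>w\<in>V. (card (line w \<inter> under))\<^sup>2)" by simp
    also have "\<dots> \<le> int (q * card under + (card under)\<^sup>2 + m * q)"
      using sum_square_line[OF under_subset] sum_card_line_under sum_excess_le by linarith
    also have "\<dots> = int q * int (card under) + int (card under) * int (card under) + int m * int q"
      by (simp add: power2_eq_square)
    also have "\<dots> \<le> int q * (12 * int q) + (12 * int q) * (12 * int q) + int m * int q"
      using b by (intro add_mono mult_mono) auto
    also have "\<dots> \<le> 160 * (int q * int q)" using m_le_mq by simp
    finally show "(\<Sum>w\<in>over. (int (card (line w \<inter> under)))\<^sup>2) \<le> 160 * (int q * int q)" .
  qed (auto intro: sum_nonneg)
  finally have e2: "e\<^sup>2 \<le> 1600 * (int q * int q * int q)" by simp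
  have "(2000 * (int m * e))\<^sup>2 = 4000000 * ((int m)\<^sup>2 * e\<^sup>2)" by (simp add: power_mult_distrib)
  also have "\<dots> \<le> 4000000 * ((int m)\<^sup>2 * (1600 * (int q * int q * int q)))"
    using e2 by (intro mult_left_mono) auto
  also have "\<dots> = 6400000000 * (int m)\<^sup>2 * (int q * int q * int q)" by simp
  also have "\<dots> \<le> int q * (int q * int q * int q)"
  proof (rule mult_right_mono)
    have "int (10000000000 * m\<^sup>2) \<le> int q" using q_large by (simp only: of_nat_le_iff)
    then have "10000000000 * (int m)\<^sup>2 \<le> int q" by simp
    moreover have "0 \<le> (int m)\<^sup>2" by simp
    ultimately show "6400000000 * (int m)\<^sup>2 \<le> int q" by linarith
  qed auto
  also have "\<dots> = (int q * int q)\<^sup>2" by (simp add: power2_eq_square)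
  finally have "2000 * (int m * e) \<le> int q * int q" by (rule power2_le_imp_le) simp
  then show ?thesis by (simp add: e_def)
qed

text \<open>The almost \<open>q^2\<close> regular vertices claim at least one missed vertex each, so
  about \<open>q^2\<close> of the budget remains for \<open>under\<close>, whose claim is about
  \<open>q * deficit\<close>.\<close>

lemma deficit_le_101: "100 * deficit \<le> 101 * int q"
proof -
  have "(\<Sum>v\<in>over. - (13 * int m) * int (card (line v \<inter> under))) \<le> (\<Sum>v\<in>over. defect v * int (card (line v \<inter> under)))"
  proof (intro sum_mono mult_right_mono)
    fix v assume "v \<in> over"
    then show "- (13 * int m) \<le> defect v" using neg_defect_le[of v] by linarith
  qed simp
  moreover have "(\<Sum>v\<in>over. - (13 * int m) * int (card (line v \<inter> under)))
      = - (13 * int m) * int (\<Sum>v\<in>over. card (line v \<inter> under))"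
    by (simp only: of_nat_sum sum_distrib_left)
  moreover have "int (card regular) \<le> (\<Sum>v\<in>regular. int (card (missed v)))"
    using sum_mono[of regular "\<lambda>_. 1" "\<lambda>v. int (card (missed v))"] card_missed_regular by simp
  ultimately have "int q * deficit \<le> int q * int q + 28 * (int m * int q)
      + 13 * (int m * int (\<Sum>v\<in>over. card (line v \<inter> under)))"
    using sum_missed_under sum_missed_under_regular card_regular by simp
  then have "2000 * (int q * deficit) \<le> 2013 * (int q * int q) + 56000 * (int m * int q)"
    using over_under_edges by linarith
  then have "int q * (100 * deficit) \<le> int q * (101 * int q)"
    using m_le_mq by (simp add: algebra_simps)
  moreover have "0 < int q" using m_le by linarith
  ultimately show ?thesis by (simp only: mult_le_cancel_left_pos)
qed

text \<open>The defects on the line of a regular vertex have a positive sum, so the vertex has a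
  neighbour in \<open>under\<close>; and each vertex of \<open>under\<close> serves at most
  \<open>q\<close> neighbours.\<close>

lemma card_under_ge: "int q - 23 * int m \<le> int (card under)"
proof -
  have "regular \<subseteq> (\<Union>b\<in>under. line b)"
  proof
    fix v assume v: "v \<in> regular"
    have "0 < (\<Sum>w\<in>line v. defect w)" using sum_defect_regular[OF v] card_missed_regular[OF v] by simp
    then obtain w where "w \<in> line v" "0 < defect w" by (meson not_le sum_nonpos)
    then show "v \<in> (\<Union>b\<in>under. line b)"
      using line_subset line_sym[of v w] v regular_subset by (auto simp: under_def)
  qed
  then have "card regular \<le> card (\<Union>b\<in>under. line b)" by (intro card_mono) auto
  also have "\<dots> \<le> (\<Sum>b\<in>under. card (line b))" by (rule card_UN_le) simp
  also have "\<dots> \<le> q * card under" by (rule sum_card_line_under)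
  finally have "int (card regular) \<le> int (q * card under)" by (rule of_nat_mono)
  then have "int q * (int q - 23 * int m) \<le> int q * int (card under)"
    using card_regular by (simp add: algebra_simps)
  moreover have "0 < int q" using m_le by linarith
  ultimately show ?thesis by (simp only: mult_le_cancel_left_pos)
qed

text \<open>Each such vertex sees a total defect of at least \<open>3 * q / 4\<close>. Two of them
  would have to share much of it, as only about \<open>q\<close> is available, but they have few
  common neighbours.\<close>

lemma card_calm_over_le: "card {v \<in> over. 4 * excess v \<le> q} \<le> 1"
proof (rule ccontr)
  let ?S = "{v \<in> over. 4 * excess v \<le> q}"
  assume "\<not> ?thesis"
  then have "2 \<le> card ?S" by simp
  then obtain T where "T \<subseteq> ?S" "card T = 2" by (rule obtain_subset_with_card_n)
  then obtain v w where vw: "v \<noteq> w" "v \<in> ?S" "w \<in> ?S" by (auto simp: card_2_iff)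
  have heavy: "3 * int q \<le> 4 * (\<Sum>u\<in>line v \<inter> under. defect u)" if "v \<in> ?S" for v
  proof -
    have "int q * 1 \<le> int q * (- defect v)" using that by (intro mult_left_mono) (auto simp: over_def)
    moreover have "4 * int (excess v) \<le> int q" using that by auto
    ultimately show ?thesis using surplus_bounds[of v] sum_line_defect_le(1)[of v] that by auto
  qed
  let ?A = "line v \<inter> under" and ?B = "line w \<inter> under"
  have "sum defect ?A + sum defect ?B = sum defect (?A \<union> ?B) + sum defect (?A \<inter> ?B)"
    by (rule sum.union_inter[symmetric]) auto
  moreover have "sum defect (?A \<union> ?B) \<le> deficit" unfolding deficit_def
    by (rule sum_mono2[OF finite_under]) (auto simp: under_def)
  \<comment> \<open>The first unit of defect at a shared vertex is charged to
    \<open>meet v w\<close>; all further units together are at most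
    \<open>deficit - card under\<close>.\<close>
  moreover have "sum defect (?A \<inter> ?B) \<le> int (meet v w) + (deficit - int (card under))"
  proof -
    have "sum defect (?A \<inter> ?B) = int (card (?A \<inter> ?B)) + (\<Sum>u\<in>?A \<inter> ?B. defect u - 1)"
      by (simp add: sum_subtractf)
    also have "(\<Sum>u\<in>?A \<inter> ?B. defect u - 1) \<le> (\<Sum>u\<in>under. defect u - 1)"
      by (rule sum_mono2[OF finite_under]) (auto simp: under_def)
    also have "\<dots> = deficit - int (card under)" by (simp add: deficit_def sum_subtractf)
    finally have "sum defect (?A \<inter> ?B) \<le> int (card (?A \<inter> ?B)) + (deficit - int (card under))" by simp
    moreover have "card (?A \<inter> ?B) \<le> meet v w" unfolding meet_def by (intro card_mono) auto
    ultimately show ?thesis by linarith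
  qed
  moreover have "meet v w \<le> 1 + excess w"
    using vw over_subset by (intro meet_le_Suc_excess) auto
  moreover have "4 * excess w \<le> q" using vw by auto
  ultimately show False
    using heavy[OF vw(2)] heavy[OF vw(3)] deficit_le_101 card_under_ge m_le by linarith
qed

lemma card_over_5m: "int (card over) \<le> 5 * int m"
proof -
  let ?S = "{v \<in> over. 4 * excess v \<le> q}"
  have "int q * int (card (over - ?S)) = (\<Sum>v\<in>over - ?S. int q)" by simp
  also have "\<dots> \<le> (\<Sum>v\<in>over - ?S. 4 * int (excess v))" by (rule sum_mono) auto
  also have "\<dots> \<le> 4 * (int m * int q)"
    using sum_excess_le_int[of "over - ?S"] over_subset by (auto simp flip: sum_distrib_left)
  finally have "int q * int (card (over - ?S)) \<le> int q * (4 * int m)" by (simp add: algebra_simps)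
  moreover have "0 < int q" using m_le by linarith
  ultimately have "int (card (over - ?S)) \<le> 4 * int m" by (simp only: mult_le_cancel_left_pos)
  moreover have "card over = card ?S + card (over - ?S)"
  proof -
    have "over \<inter> ?S = ?S" by auto
    then show ?thesis using card_Int_Diff[OF finite_over, of ?S] by simp
  qed
  ultimately show ?thesis using card_calm_over_le m_le by linarith
qed

lemma surplus_le: "surplus \<le> 11 * int m"
proof -
  have "int q * surplus = (\<Sum>v\<in>over. int q * (- defect v))" by (simp add: surplus_def sum_distrib_left)
  also have "\<dots> \<le> (\<Sum>v\<in>over. 2 * int q + int (excess v))"
  proof (rule sum_mono)
    fix v assume "v \<in> over"
    then show "int q * (- defect v) \<le> 2 * int q + int (excess v)"
      using surplus_bounds[of v] sum_line_defect_le[of v] deficit_le_101 by linarith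
  qed
  also have "\<dots> = 2 * (int q * int (card over)) + (\<Sum>v\<in>over. int (excess v))"
    by (simp add: sum.distrib algebra_simps)
  also have "\<dots> \<le> 2 * (int q * (5 * int m)) + int m * int q"
    using card_over_5m sum_excess_le_int[OF over_subset] by (intro add_mono mult_left_mono) auto
  finally have "int q * surplus \<le> int q * (11 * int m)" by (simp add: algebra_simps)
  moreover have "0 < int q" using m_le by linarith
  ultimately show ?thesis by (simp only: mult_le_cancel_left_pos)
qed

lemma deficit_le: "deficit \<le> int q + 12 * int m"
  using surplus_le sum_under_minus_over sum_defect_le m_le by linarith

text \<open>After both claims only \<open>O(m * q)\<close> of the budget is left, and each regular
  vertex that is not tame takes an extra unit of it. This gives \<open>(5 + 45 + 23) * m * q\<close>
  for these, plus \<open>23 * m * q\<close> for the vertices that are not regular.\<close>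

lemma card_not_tame: "int (card (V - tame)) \<le> 96 * (int m * int q)"
proof -
  have "(\<Sum>v\<in>over. defect v * int (card under)) \<le> (\<Sum>v\<in>over. defect v * int (card (line v \<inter> under)))"
  proof (intro sum_mono mult_left_mono_neg)
    fix v assume v: "v \<in> over"
    show "int (card (line v \<inter> under)) \<le> int (card under)" by (simp add: card_mono)
    show "defect v \<le> 0" using v by (simp add: over_def)
  qed
  moreover have "(\<Sum>v\<in>over. defect v * int (card under)) = - (surplus * int (card under))"
    by (simp add: surplus_def sum_negf sum_distrib_right)
  moreover have "surplus * int (card under) \<le> (11 * int m) * (2 * int q)"
    using surplus_le card_under_le deficit_le m_le by (intro mult_mono) linarith+
  moreover have "int q * (int q - 23 * int m) \<le> int q * deficit"
    using card_under_ge card_under_le by (intro mult_left_mono) auto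
  ultimately have U: "int q * int q - 45 * (int m * int q) \<le> (\<Sum>v\<in>under. int (card (missed v)))"
    using sum_missed_under by (simp add: algebra_simps)
  have "int (card regular) + int (card (regular - tame)) = (\<Sum>v\<in>regular. 1 + (if v \<in> regular - tame then 1 else 0))"
  proof -
    have "regular \<inter> {v. v \<notin> tame} = regular - tame" by auto
    then show ?thesis by (simp add: sum.distrib sum.If_cases)
  qed
  also have "\<dots> \<le> (\<Sum>v\<in>regular. int (card (missed v)))"
  proof (rule sum_mono)
    fix v assume v: "v \<in> regular"
    show "1 + (if v \<in> regular - tame then 1 else 0) \<le> int (card (missed v))"
      using v card_missed_regular[OF v] by (cases "card (missed v) = 1") (auto simp: tame_def)
  qed
  finally have "int (card (regular - tame)) + int (card regular) \<le> (\<Sum>v\<in>regular. int (card (missed v)))" by simp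
  moreover have "card (V - tame) \<le> card (V - regular) + card (regular - tame)"
  proof -
    have "card (V - tame) \<le> card ((V - regular) \<union> (regular - tame))"
      using fin by (intro card_mono) auto
    then show ?thesis using card_Un_le[of "V - regular" "regular - tame"] by linarith
  qed
  ultimately show ?thesis using U sum_missed_under_regular card_regular card_not_regular by linarith
qed


text \<open>For a neighbour \<open>u \<noteq> y\<close> of \<open>v\<close> let \<open>z\<close> be its missed neighbour. If \<open>z\<close> were on \<open>line y\<close>,
  then \<open>v\<close>, \<open>u\<close>, \<open>z\<close>, \<open>y\<close> would form a quadrilateral; hence the \<open>q\<close> neighbours of \<open>u\<close> other than
  \<open>v\<close> have to account for all the at least \<open>q + 1\<close> points of \<open>line y\<close>, and one of them does so twice.\<close>

lemma card_tame_neighbours_le_excess: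
  assumes v: "v \<in> tame" and y: "y \<in> line v" "y \<in> missed v" "y \<notin> under"
  shows "card (line v \<inter> tame - {y}) \<le> excess y"
proof -
  have V: "v \<in> V" "y \<in> V" using v tame_subset y missed_subset by auto
  have exv: "excess v = 0" using v by (auto simp: tame_def regular_def)
  have yv: "line y \<inter> line v = {}" "y \<noteq> v" using y by (auto simp: missed_def)
  have vy: "v \<in> line y" using line_sym[OF V(1) y(1)] .
  have mv: "missed v = {y}" using v y by (auto simp: tame_def card_1_singleton_iff)
  have ly: "q + 1 \<le> card (line y)" using y V by (simp add: under_def defect_def)
  have one: "meet p v \<le> 1" if "p \<in> V" "p \<noteq> v" for p
    using meet_le_Suc_excess[OF that] exv by simp
  have "\<exists>w. w \<in> line u - {v} \<and> w \<noteq> y \<and> 2 \<le> meet w y" if u: "u \<in> line v \<inter> tame - {y}" for u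
  proof -
    have ut: "u \<in> tame" "u \<in> regular" "u \<in> V" "u \<in> line v" using u tame_subset by (auto simp: tame_def)
    have uy: "u \<notin> line y" using ut yv by auto
    have lu: "card (line u) = q + 1" using ut by (simp add: regular_def defect_def)
    obtain z where z: "z \<in> line u" "z \<in> missed u" using missed_neighbour[OF ut(2)] .
    have mu: "missed u = {z}" using ut(1) z by (auto simp: tame_def card_1_singleton_iff)
    have zV: "z \<in> V" using z line_subset by auto
    have zv: "z \<noteq> v" using missed_sym[OF ut(3) z(2)] mv u by auto
    have zy: "z \<notin> line y"
    proof
      assume "z \<in> line y"
      then have "{u, y} \<subseteq> line z \<inter> line v"
        using line_sym[OF ut(3) z(1)] line_sym[OF V(2), of z] ut y by simp
      then have "card {u, y} \<le> meet z v" unfolding meet_def by (intro card_mono) auto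
      then show False using one[OF zV zv] u by auto
    qed
    have "\<exists>w. w \<in> line u \<inter> line c \<and> w \<noteq> v" if c: "c \<in> line y" for c
    proof -
      have cV: "c \<in> V" "c \<noteq> u" "c \<notin> missed u" using c uy mu zy line_subset by auto
      then obtain w where w: "w \<in> line c" "w \<in> line u" by (auto simp: missed_def)
      have "w \<noteq> v" using w(1) c yv line_sym[OF cV(1), of w] by auto
      then show ?thesis using w by auto
    qed
    then obtain g where g: "\<And>c. c \<in> line y \<Longrightarrow> g c \<in> line u \<inter> line c \<and> g c \<noteq> v" by metis
    have "v \<in> line u" using line_sym[OF V(1) ut(4)] .
    then have "card (line u - {v}) = q" using lu by simp
    moreover have "card (g ` line y) \<le> card (line u - {v})" using g by (intro card_mono) auto
    ultimately have "card (g ` line y) < card (line y)" using ly by linarith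
    then obtain c c' where c: "c \<in> line y" "c' \<in> line y" "c \<noteq> c'" "g c = g c'"
      using pigeonhole[of g "line y"] by (auto simp: inj_on_def)
    have "{c, c'} \<subseteq> line (g c) \<inter> line y"
      using c g[OF c(1)] g[OF c(2)] line_sym[of c "g c"] line_sym[of c' "g c"] line_subset[of y] by auto
    then have "card {c, c'} \<le> meet (g c) y" unfolding meet_def by (intro card_mono) auto
    moreover have "g c \<noteq> y" using g[OF c(1)] line_sym[OF ut(3)] uy by auto
    ultimately show ?thesis using g[OF c(1)] c(3) by (intro exI[of _ "g c"]) auto
  qed
  then obtain w where w: "\<And>u. u \<in> line v \<inter> tame - {y} \<Longrightarrow> w u \<in> line u - {v} \<and> w u \<noteq> y \<and> 2 \<le> meet (w u) y"
    by metis
  \<comment> \<open>No vertex other than \<open>v\<close> has two common neighbours with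
    \<open>v\<close>, so different \<open>u\<close> charge different \<open>w u\<close>, each for
    one unit of \<open>excess y\<close>.\<close>
  have "inj_on w (line v \<inter> tame - {y})"
  proof (rule inj_onI)
    fix u u' assume h: "u \<in> line v \<inter> tame - {y}" "u' \<in> line v \<inter> tame - {y}" "w u = w u'"
    have wV: "w u \<in> V" "w u \<noteq> v" using w[OF h(1)] line_subset by auto
    have "{u, u'} \<subseteq> line (w u) \<inter> line v"
      using h w[OF h(1)] w[OF h(2)] line_sym[of u "w u"] line_sym[of u' "w u"] tame_subset by auto
    then have "card {u, u'} \<le> meet (w u) v" unfolding meet_def by (intro card_mono) auto
    then show "u = u'" using one[OF wV] by (cases "u = u'") auto
  qed
  then have "card (line v \<inter> tame - {y}) = card (w ` (line v \<inter> tame - {y}))" by (simp add: card_image)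
  also have "\<dots> = (\<Sum>p\<in>w ` (line v \<inter> tame - {y}). 1)" by simp
  also have "\<dots> \<le> (\<Sum>p\<in>w ` (line v \<inter> tame - {y}). meet p y - 1)"
    by (rule sum_mono) (use w in force)
  also have "\<dots> \<le> excess y" unfolding excess_def
    by (rule sum_mono2) (use fin w line_subset in auto)
  finally show ?thesis .
qed

section \<open>Loops at the vertices of small degree\<close>

definition paired :: "'a set" where
  "paired = {v \<in> tame. \<exists>y\<in>under. y \<in> line v \<and> y \<in> missed v}"

lemma paired_subset: "paired \<subseteq> tame"
  by (auto simp: paired_def)

lemma card_line_le_2q:
  assumes "v \<in> V" shows "card (line v) \<le> 2 * q"
proof (cases "v \<in> over")
  case True
  then have "int (card (line v)) \<le> int q + 1 + 13 * int m"
    using neg_defect_le[OF True] by (simp add: defect_def)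
  then show ?thesis using m_le by linarith
next
  case False
  then have "card (line v) \<le> q + 1" using assms by (simp add: over_def defect_def)
  then show ?thesis using m_le by linarith
qed

text \<open>If the missed neighbour \<open>y\<close> of a tame \<open>v\<close> is not in
  \<open>under\<close>, then \<open>excess y\<close> is at least the number of tame neighbours of
  \<open>v\<close> other than \<open>y\<close>. So \<open>v\<close> has about \<open>q / 2\<close>
  neighbours that are not tame, or it lies on the line of one of the few \<open>y\<close> with large
  excess. The constant is \<open>96 + 8 + 1\<close>, the 1 paying for
  \<open>crowded\<close>.\<close>

lemma card_not_paired: "int (card (V - paired)) \<le> 105 * (int m * int q)"
proof -
  define crowded where "crowded = {v \<in> V. q div 2 \<le> card (line v \<inter> (V - tame))}"
  define bad where "bad = {y \<in> V. q \<le> 4 * excess y}"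
  define wild where "wild = (\<Union>y\<in>bad. line y)"
  have fb: "finite bad" using fin by (auto simp: bad_def)
  have cc: "card crowded < 500 * m"
  proof (rule card_rich_lines_less[where D = "V - tame" and r = "q div 2"])
    have "250000 * (int m * int m) \<le> int m * int q" using m_le mult_left_mono[of "250000 * int m" "int q" "int m"] by simp
    moreover have "int q \<le> 2 * int (q div 2)" using even_q by auto
    then have "int m * int q \<le> 2 * (int m * int (q div 2))"
      using mult_left_mono[of "int q" "2 * int (q div 2)" "int m"] by simp
    moreover have "0 < int m * int q" using m_le by (intro mult_pos_pos) linarith+
    moreover have "(\<Sum>v\<in>V. int (excess v)) \<le> int m * int q" by (rule sum_excess_le_int) simp
    ultimately have "int (card (V - tame)) + 250000 * (int m * int m) + (\<Sum>v\<in>V. int (excess v)) < 500 * (int m * int (q div 2))"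
      using card_not_tame by linarith
    then have "int (card (V - tame) + (500 * m)\<^sup>2 + (\<Sum>v\<in>V. excess v)) < int (500 * m * (q div 2))"
      by (simp add: power2_eq_square)
    then show "card (V - tame) + (500 * m)\<^sup>2 + (\<Sum>v\<in>V. excess v) < 500 * m * (q div 2)"
      by (simp only: of_nat_less_iff)
  qed (auto simp: crowded_def)
  have cw: "int (card wild) \<le> 8 * (int m * int q)"
  proof -
    have "int q * int (card bad) = (\<Sum>y\<in>bad. int q)" by simp
    also have "\<dots> \<le> (\<Sum>y\<in>bad. 4 * int (excess y))" by (rule sum_mono) (auto simp: bad_def)
    also have "\<dots> \<le> 4 * (int m * int q)"
      using sum_excess_le_int[of bad] by (auto simp: bad_def simp flip: sum_distrib_left)
    finally have "int q * int (card bad) \<le> int q * (4 * int m)" by (simp add: algebra_simps)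
    moreover have "0 < int q" using m_le by linarith
    ultimately have b: "int (card bad) \<le> 4 * int m" by (simp only: mult_le_cancel_left_pos)
    have "card wild \<le> (\<Sum>y\<in>bad. card (line y))" unfolding wild_def by (rule card_UN_le[OF fb])
    also have "\<dots> \<le> (\<Sum>y\<in>bad. 2 * q)" by (rule sum_mono) (auto simp: bad_def card_line_le_2q)
    finally have "card wild \<le> card bad * (2 * q)" by simp
    then have "int (card wild) \<le> int (card bad * (2 * q))" by (rule of_nat_mono)
    also have "\<dots> = int (card bad) * (2 * int q)" by simp
    also have "\<dots> \<le> (4 * int m) * (2 * int q)" using b by (intro mult_right_mono) auto
    finally show ?thesis by simp
  qed
  have "tame - crowded - wild \<subseteq> paired"
  proof
    fix v assume v: "v \<in> tame - crowded - wild"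
    have vt: "v \<in> tame" "v \<in> regular" "v \<in> V" using v tame_subset by (auto simp: tame_def)
    obtain y where y: "y \<in> line v" "y \<in> missed v" using missed_neighbour[OF vt(2)] .
    have "y \<in> under"
    proof (rule ccontr)
      assume "y \<notin> under"
      then have le: "card (line v \<inter> tame - {y}) \<le> excess y"
        using card_tame_neighbours_le_excess[OF vt(1) y] by simp
      have "y \<in> V" "v \<in> line y" using y line_subset line_sym[OF vt(3) y(1)] by auto
      then have "y \<in> V - bad" using v by (auto simp: wild_def)
      then have small: "4 * excess y < q" by (auto simp: bad_def)
      have "card (line v) = q + 1" using vt by (simp add: regular_def defect_def)
      moreover have "card (line v) \<le> card (line v \<inter> tame - {y}) + card (line v \<inter> (V - tame)) + 1"
      proof -
        have "card (line v) \<le> card (insert y ((line v \<inter> tame - {y}) \<union> (line v \<inter> (V - tame))))"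
          using line_subset by (intro card_mono) auto
        also have "\<dots> \<le> 1 + card ((line v \<inter> tame - {y}) \<union> (line v \<inter> (V - tame)))"
          by (simp add: card_insert_if)
        finally show ?thesis
          using card_Un_le[of "line v \<inter> tame - {y}" "line v \<inter> (V - tame)"] by linarith
      qed
      moreover have "card (line v \<inter> (V - tame)) < q div 2" using v vt by (auto simp: crowded_def)
      ultimately show False using le small by linarith
    qed
    then show "v \<in> paired" using vt y by (auto simp: paired_def)
  qed
  then have "card (V - paired) \<le> card ((V - tame) \<union> (crowded \<union> wild))"
    using fin fb by (intro card_mono) (auto simp: crowded_def wild_def)
  then have "card (V - paired) \<le> card (V - tame) + (card crowded + card wild)"
    using card_Un_le[of "V - tame" "crowded \<union> wild"] card_Un_le[of crowded wild] by linarith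
  then show ?thesis using card_not_tame cc cw m_le_mq m_le
    mult_left_mono[OF m_le(1), of "int m"] mult_left_mono[of 500 "int q" "int m"] by linarith
qed

lemma sum_swap_off_diagonal:
  "(\<Sum>v\<in>V. \<Sum>u\<in>V - {v}. h u v) = (\<Sum>v\<in>V. \<Sum>u\<in>V - {v}. h v u)" for h :: "'a \<Rightarrow> 'a \<Rightarrow> nat"
proof -
  have 1: "V - {v} = {u \<in> V. u \<noteq> v}" for v by auto
  have 2: "V - {v} = {u \<in> V. v \<noteq> u}" for v by auto
  have "(\<Sum>v\<in>V. \<Sum>u\<in>V - {v}. h u v) = (\<Sum>v\<in>V. \<Sum>u\<in>{u \<in> V. u \<noteq> v}. h u v)"
    by (simp only: 1)
  also have "\<dots> = (\<Sum>u\<in>V. \<Sum>v\<in>{v \<in> V. u \<noteq> v}. h u v)"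
    by (rule sum.swap_restrict[OF fin fin])
  also have "\<dots> = (\<Sum>v\<in>V. \<Sum>u\<in>V - {v}. h v u)" by (simp only: 2)
  finally show ?thesis .
qed

text \<open>The loops sit at the vertices of degree at most \<open>q\<close>, the future absolute points. The loop at
  \<open>y\<close> gives \<open>line y\<close> and \<open>line v\<close> a common point for every neighbour \<open>v\<close> of \<open>y\<close>, and for almost
  all of them, the paired ones, it is the first common point.\<close>

lemma add_loops:
  obtains R' where "sym_structure V R' q" "\<forall>u v. u \<noteq> v \<longrightarrow> (R' u v \<longleftrightarrow> R u v)"
    "(\<Sum>v\<in>V. \<bar>sym_structure.defect V R' q v\<bar>) \<le> int (235 * m)"
    "(\<Sum>v\<in>V. sym_structure.excess V R' v) \<le> 235 * m * q"
proof -
  define R' where "R' = (\<lambda>u v. R u v \<or> u = v \<and> v \<in> under)"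
  interpret S: sym_structure V R' q
    by standard (use fin card_V sym in \<open>auto simp: R'_def\<close>)
  have notin: "v \<notin> line v" for v using irrefl by (auto simp: line_def)
  have lineS: "S.line v = (if v \<in> under then insert v (line v) else line v)" for v
    unfolding S.line_def line_def by (auto simp: R'_def under_def)
  have "(\<Sum>v\<in>V. \<bar>S.defect v\<bar>) = (\<Sum>v\<in>V. (if v \<in> over then - defect v else 0) + (if v \<in> under then defect v - 1 else 0))"
  proof (rule sum.cong[OF refl])
    fix v assume "v \<in> V"
    then show "\<bar>S.defect v\<bar> = (if v \<in> over then - defect v else 0) + (if v \<in> under then defect v - 1 else 0)"
      using notin[of v] by (auto simp: S.defect_def lineS defect_def over_def under_def)
  qed
  also have "\<dots> = surplus + (deficit - int (card under))"
    using fin over_subset under_subset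
    by (simp add: sum.distrib sum.If_cases Int_absorb1 surplus_def deficit_def sum_subtractf)
  \<comment> \<open>The sum is in fact at most \<open>(11 + 12 + 23) * m\<close>; 235 comes from the
    excess and serves for both.\<close>
  also have "\<dots> \<le> int (235 * m)"
    using surplus_le deficit_le card_under_ge by simp
  finally have def_le: "(\<Sum>v\<in>V. \<bar>S.defect v\<bar>) \<le> int (235 * m)" .
  have "\<forall>v\<in>paired. \<exists>y. y \<in> under \<and> y \<in> line v \<and> y \<in> missed v" by (auto simp: paired_def)
  then obtain y where y: "\<And>v. v \<in> paired \<Longrightarrow> y v \<in> under \<and> y v \<in> line v \<and> y v \<in> missed v"
    by metis
  \<comment> \<open>In the count below, \<open>i u v\<close> marks a common point created by the
    loop at \<open>u\<close>, and \<open>g v u\<close> marks the case that this is the first common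
    point, so that it adds nothing to the excess.\<close>
  define g where "g = (\<lambda>v u. if v \<in> paired \<and> u = y v then 1 else 0 :: nat)"
  define i where "i = (\<lambda>u v. if u \<in> under \<and> v \<in> line u then 1 else 0 :: nat)"
  have pu: "v \<notin> under" if "v \<in> paired" for v
    using that by (auto simp: paired_def tame_def regular_def under_def)
  have meetS: "S.meet u v \<le> meet u v + i u v + i v u" if uv: "u \<in> V" "v \<in> V" "u \<noteq> v" for u v
  proof -
    let ?A = "if u \<in> under \<and> v \<in> line u then {u} else {}"
    let ?B = "if v \<in> under \<and> u \<in> line v then {v} else {}"
    have "S.line u \<inter> S.line v \<subseteq> (line u \<inter> line v) \<union> (?A \<union> ?B)"
      using uv line_sym[OF uv(1), of v] line_sym[OF uv(2), of u] by (auto simp: lineS split: if_splits)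
    then have "S.meet u v \<le> card ((line u \<inter> line v) \<union> (?A \<union> ?B))"
      unfolding S.meet_def by (intro card_mono) auto
    also have "\<dots> \<le> meet u v + (card ?A + card ?B)"
      unfolding meet_def using card_Un_le[of "line u \<inter> line v" "?A \<union> ?B"] card_Un_le[of ?A ?B] by linarith
    finally have "S.meet u v \<le> meet u v + (card ?A + card ?B)" .
    moreover have "card ?A = i u v" "card ?B = i v u" by (simp_all add: i_def)
    ultimately show ?thesis by simp
  qed
  have g1: "g u v = 0 \<and> meet u v = 0 \<and> i u v = 1 \<and> i v u = 0" if "g v u \<noteq> 0" "v \<in> V" for u v
  proof -
    have h: "v \<in> paired" "u = y v" using that by (auto simp: g_def split: if_splits)
    have "u \<in> under" "u \<in> line v" "u \<in> missed v" using y[OF h(1)] h by auto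
    then show ?thesis
      using pu[of u] pu[OF h(1)] line_sym[OF that(2), of u] by (auto simp: g_def i_def missed_def meet_def)
  qed
  have pt: "S.meet u v - 1 + g v u + g u v \<le> (meet u v - 1) + i u v + i v u"
    if uv: "u \<in> V" "v \<in> V" "u \<noteq> v" for u v
  proof -
    have "g v u \<le> 1" "g u v \<le> 1" by (auto simp: g_def)
    then show ?thesis
      using meetS[OF uv] g1[of v u] g1[of u v] uv meet_commute[of u v]
      by (cases "g v u = 0"; cases "g u v = 0") auto
  qed
  have "(\<Sum>v\<in>V. \<Sum>u\<in>V - {v}. S.meet u v - 1 + g v u + g u v) \<le> (\<Sum>v\<in>V. \<Sum>u\<in>V - {v}. (meet u v - 1) + i u v + i v u)"
    by (intro sum_mono pt) auto
  then have "(\<Sum>v\<in>V. S.excess v) + (\<Sum>v\<in>V. \<Sum>u\<in>V - {v}. g v u) + (\<Sum>v\<in>V. \<Sum>u\<in>V - {v}. g u v)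
     \<le> (\<Sum>v\<in>V. excess v) + (\<Sum>v\<in>V. \<Sum>u\<in>V - {v}. i u v) + (\<Sum>v\<in>V. \<Sum>u\<in>V - {v}. i v u)"
    by (simp add: sum.distrib S.excess_def excess_def)
  then have main: "(\<Sum>v\<in>V. S.excess v) + 2 * (\<Sum>v\<in>V. \<Sum>u\<in>V - {v}. g v u)
     \<le> (\<Sum>v\<in>V. excess v) + 2 * (\<Sum>v\<in>V. \<Sum>u\<in>V - {v}. i v u)"
    using sum_swap_off_diagonal[of g] sum_swap_off_diagonal[of i] by linarith
  have gsum: "(\<Sum>v\<in>V. \<Sum>u\<in>V - {v}. g v u) = card paired"
  proof -
    have "(\<Sum>u\<in>V - {v}. g v u) = (if v \<in> paired then 1 else 0)" for v
    proof (cases "v \<in> paired")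
      case True
      then have "y v \<in> V - {v}" using y[OF True] missed_def by auto
      then show ?thesis using True fin by (simp add: g_def)
    qed (simp add: g_def)
    moreover have "V \<inter> paired = paired" using paired_subset tame_subset by auto
    ultimately show ?thesis using fin by (simp add: sum.If_cases)
  qed
  have isum: "(\<Sum>v\<in>V. \<Sum>u\<in>V - {v}. i v u) \<le> q * card under"
  proof -
    have "(\<Sum>u\<in>V - {v}. i v u) \<le> (if v \<in> under then q else 0)" for v
    proof (cases "v \<in> under")
      case True
      have "(\<Sum>u\<in>V - {v}. i v u) = card ((V - {v}) \<inter> line v)"
        using True fin by (simp add: i_def sum.If_cases)
      also have "\<dots> \<le> card (line v)" by (intro card_mono) auto
      finally show ?thesis using True card_line_under[OF True] by simp
    qed (simp add: i_def)
    then have "(\<Sum>v\<in>V. \<Sum>u\<in>V - {v}. i v u) \<le> (\<Sum>v\<in>V. if v \<in> under then q else 0)" by (rule sum_mono)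
    also have "\<dots> = q * card under" using fin under_subset by (simp add: sum.If_cases Int_absorb1)
    finally show ?thesis .
  qed
  have "int q * int (card under) \<le> int q * (int q + 12 * int m)"
    using card_under_le deficit_le by (intro mult_left_mono) auto
  then have qu: "int q * int (card under) \<le> int q * int q + 12 * (int m * int q)"
    by (simp add: algebra_simps)
  have "paired \<subseteq> V" using paired_subset tame_subset by auto
  then have "card V = card paired + card (V - paired)"
    using fin card_mono[OF fin, of paired] by (simp add: card_Diff_subset finite_subset)
  moreover have "int (card V) = int q * int q + int q + 1" by (simp add: card_V power2_eq_square)
  ultimately have "int q * int q - 105 * (int m * int q) \<le> int (card paired)"
    using card_not_paired by linarith
  moreover have "int ((\<Sum>v\<in>V. S.excess v) + 2 * card paired) \<le> int (m * q + 2 * (q * card under))"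
    using main gsum isum sum_excess_le by linarith
  then have "int (\<Sum>v\<in>V. S.excess v) + 2 * int (card paired) \<le> int m * int q + 2 * (int q * int (card under))"
    by (simp only: of_nat_add of_nat_mult of_nat_numeral)
  \<comment> \<open>The terms of order \<open>q^2\<close> cancel, leaving
    \<open>1 + 2 * 12 + 2 * 105 = 235\<close>.\<close>
  ultimately have "int (\<Sum>v\<in>V. S.excess v) \<le> 235 * (int m * int q)" using qu by linarith
  then have "int (\<Sum>v\<in>V. S.excess v) \<le> int (235 * m * q)" by simp
  then have ex_le: "(\<Sum>v\<in>V. S.excess v) \<le> 235 * m * q" by (simp only: of_nat_le_iff)
  show ?thesis
    by (rule that[OF S.sym_structure_axioms _ def_le ex_le]) (auto simp: R'_def)
qed

end

section \<open>Polarity graphs\<close>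

lemma C4_copyI:
  assumes G: "simple_graph G"
    and e: "{u, a} \<in> edges G" "{a, v} \<in> edges G" "{v, b} \<in> edges G" "{b, u} \<in> edges G"
    and ne: "u \<noteq> v" "a \<noteq> b"
  shows "({u, a, v, b}, {{u, a}, {a, v}, {v, b}, {b, u}}) \<in> C4_copies G"
proof -
  have E: "x \<subseteq> verts G \<and> card x = 2" if "x \<in> edges G" for x
    using G that by (auto simp: simple_graph_def)
  have c: "card {u, a} = 2" "card {a, v} = 2" "card {v, b} = 2" "card {b, u} = 2"
    using E[OF e(1)] E[OF e(2)] E[OF e(3)] E[OF e(4)] by simp_all
  then have d: "u \<noteq> a" "a \<noteq> v" "v \<noteq> b" "b \<noteq> u" by auto
  let ?H = "({u, a, v, b}, {{u, a}, {a, v}, {v, b}, {b, u}})"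
  have "subgraph_of ?H G"
    using E[OF e(1)] E[OF e(3)] e c
    by (simp add: subgraph_of_def simple_graph_def verts_def edges_def)
  moreover have "graph_isomorphic ?H C4"
  proof -
    define f :: "'a \<Rightarrow> nat" where "f = (\<lambda>x. if x = u then 0 else if x = a then 1 else if x = v then 2 else 3)"
    have f: "f u = 0" "f a = 1" "f v = 2" "f b = 3" using d ne by (auto simp: f_def)
    have "inj_on f {u, a, v, b}" using f by (auto simp: inj_on_def)
    then have "bij_betw f (verts ?H) (verts C4)" by (simp add: bij_betw_def verts_def C4_def f)
    moreover have "edges C4 = (\<lambda>e. f ` e) ` edges ?H" by (simp add: edges_def C4_def f)
    ultimately show ?thesis unfolding graph_isomorphic_def by blast
  qed
  ultimately show ?thesis by (simp add: C4_copies_def)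
qed

lemma finite_edges: "simple_graph G \<Longrightarrow> finite (edges G)"
  by (rule finite_subset[of _ "Pow (verts G)"]) (auto simp: simple_graph_def)

lemma finite_C4_copies:
  assumes "simple_graph G" shows "finite (C4_copies G)"
proof (rule finite_subset)
  show "C4_copies G \<subseteq> Pow (verts G) \<times> Pow (edges G)"
    by (auto simp: C4_copies_def subgraph_of_def verts_def edges_def)
  show "finite (Pow (verts G) \<times> Pow (edges G))"
    using assms finite_edges[OF assms] by (simp add: simple_graph_def)
qed

lemma card_verts_C4_copy:
  assumes "H \<in> C4_copies G" shows "card (verts H) = 4"
proof -
  obtain f where "bij_betw f (verts H) (verts C4)"
    using assms by (auto simp: C4_copies_def graph_isomorphic_def)
  then have "card (verts H) = card (verts C4)" by (rule bij_betw_same_card)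
  then show ?thesis by (simp add: C4_def verts_def)
qed

lemma handshake:
  assumes fin: "finite V" and E: "\<And>e. e \<in> E \<Longrightarrow> e \<subseteq> V \<and> card e = 2"
  shows "(\<Sum>v\<in>V. card {w \<in> V. {v, w} \<in> E}) = 2 * card E"
proof -
  have finE: "finite E" by (rule finite_subset[of _ "Pow V"]) (use fin E in auto)
  have two: "card {w \<in> V. v \<in> e \<and> {v, w} = e} = (if v \<in> e then 1 else 0)" if e: "e \<in> E" for v e
  proof (cases "v \<in> e")
    case True
    have "card e = 2" using E[OF e] by simp
    then obtain x y where xy: "e = {x, y}" "x \<noteq> y" unfolding card_2_iff by blast
    have "{w \<in> V. v \<in> e \<and> {v, w} = e} = {if v = x then y else x}"
      using True xy E[OF e] by (auto simp: doubleton_eq_iff)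
    then show ?thesis using True by simp
  qed simp
  have "card {w \<in> V. {v, w} \<in> E} = (\<Sum>e\<in>E. if v \<in> e then 1 else 0)" for v
  proof -
    have "{w \<in> V. {v, w} \<in> E} = (\<Union>e\<in>E. {w \<in> V. v \<in> e \<and> {v, w} = e})" by auto
    also have "card \<dots> = (\<Sum>e\<in>E. card {w \<in> V. v \<in> e \<and> {v, w} = e})"
      by (rule card_UN_disjoint[OF finE]) (use fin in auto)
    also have "\<dots> = (\<Sum>e\<in>E. if v \<in> e then 1 else 0)" by (rule sum.cong[OF refl two])
    finally show ?thesis .
  qed
  then have "(\<Sum>v\<in>V. card {w \<in> V. {v, w} \<in> E}) = (\<Sum>v\<in>V. \<Sum>e\<in>E. if v \<in> e then 1 else 0)"
    by simp
  also have "\<dots> = (\<Sum>e\<in>E. \<Sum>v\<in>V. if v \<in> e then 1 else 0)" by (rule sum.swap)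
  also have "\<dots> = (\<Sum>e\<in>E. 2)"
  proof (rule sum.cong[OF refl])
    fix e assume e: "e \<in> E"
    then have "V \<inter> e = e" using E by blast
    then show "(\<Sum>v\<in>V. if v \<in> e then 1 else 0) = (2::nat)" using fin E[OF e] by (simp add: sum.If_cases)
  qed
  finally show ?thesis by simp
qed

text \<open>Two vertices with \<open>k\<close> common neighbours have at least \<open>k - 1\<close>
  ordered pairs of them, and each such pair completes a quadruple of vertices of one copy. A copy
  admits at most \<open>4^4 = 256\<close> quadruples; a crude count is enough here.\<close>

lemma excess_le_C4_copies:
  assumes G: "simple_graph G" and cV: "card (verts G) = q\<^sup>2 + q + 1"
  shows "(\<Sum>v\<in>verts G. sym_structure.excess (verts G) (\<lambda>u v. {u, v} \<in> edges G) v) \<le> 256 * card (C4_copies G)"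
proof -
  define V where "V = verts G"
  have finV: "finite V" using G by (simp add: V_def simple_graph_def)
  interpret sym_structure V "\<lambda>u v. {u, v} \<in> edges G" q
    by standard (use finV cV in \<open>auto simp: V_def insert_commute\<close>)
  define pairs where "pairs = (\<lambda>S::'a set. {(a, b) \<in> S \<times> S. a \<noteq> b})"
  have card_pairs: "card S - 1 \<le> card (pairs S)" if "finite S" for S
  proof (cases "S = {}")
    case False
    then obtain s where s: "s \<in> S" by auto
    have "card ({s} \<times> (S - {s})) \<le> card (pairs S)"
      by (rule card_mono) (use that s in \<open>auto simp: pairs_def intro: finite_subset[of _ "S \<times> S"]\<close>)
    then show ?thesis using s that by (simp add: card_cartesian_product)
  qed simp
  have fin_pairs: "finite (pairs S)" if "finite S" for S
    by (rule finite_subset[of _ "S \<times> S"]) (use that in \<open>auto simp: pairs_def\<close>)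
  define Q where "Q = (SIGMA v:V. SIGMA u:V - {v}. pairs (line u \<inter> line v))"
  have "(\<Sum>v\<in>V. excess v) \<le> (\<Sum>v\<in>V. \<Sum>u\<in>V - {v}. card (pairs (line u \<inter> line v)))"
    unfolding excess_def meet_def by (intro sum_mono card_pairs) simp
  also have "\<dots> = card Q"
    using finV by (simp add: Q_def fin_pairs)
  also have "card Q \<le> card (\<Union>H\<in>C4_copies G. verts H \<times> verts H \<times> verts H \<times> verts H)"
  proof (rule card_mono)
    show "finite (\<Union>H\<in>C4_copies G. verts H \<times> verts H \<times> verts H \<times> verts H)"
      using finite_C4_copies[OF G] by (auto simp: C4_copies_def subgraph_of_def simple_graph_def)
    show "Q \<subseteq> (\<Union>H\<in>C4_copies G. verts H \<times> verts H \<times> verts H \<times> verts H)"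
    proof
      fix z assume "z \<in> Q"
      then obtain v u a b where z: "z = (v, u, a, b)" and uv: "u \<noteq> v" "a \<noteq> b"
        and e: "{u, a} \<in> edges G" "{u, b} \<in> edges G" "{v, a} \<in> edges G" "{v, b} \<in> edges G"
        by (auto simp: Q_def pairs_def line_def)
      have "({u, a, v, b}, {{u, a}, {a, v}, {v, b}, {b, u}}) \<in> C4_copies G"
        using e uv by (intro C4_copyI[OF G]) (simp_all add: insert_commute)
      then show "z \<in> (\<Union>H\<in>C4_copies G. verts H \<times> verts H \<times> verts H \<times> verts H)"
        unfolding z by (rule UN_I) (simp add: verts_def)
    qed
  qed
  also have "\<dots> \<le> (\<Sum>H\<in>C4_copies G. card (verts H \<times> verts H \<times> verts H \<times> verts H))"
    by (rule card_UN_le[OF finite_C4_copies[OF G]])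
  also have "\<dots> = (\<Sum>H\<in>C4_copies G. 256)"
    by (rule sum.cong) (simp_all add: card_cartesian_product card_verts_C4_copy)
  finally show ?thesis by (simp add: V_def)
qed

section \<open>The polarity graph of a complete structure\<close>

locale polarity_structure = sym_structure +
  assumes defect_0: "v \<in> V \<Longrightarrow> defect v = 0"
    and meet_1: "u \<in> V \<Longrightarrow> v \<in> V \<Longrightarrow> u \<noteq> v \<Longrightarrow> meet u v = 1"
    and q_pos: "1 \<le> q"
begin

definition absolute :: "'a set" where
  "absolute = {v \<in> V. v \<in> line v}"

definition pol :: "'a + 'a set \<Rightarrow> 'a + 'a set" where
  "pol = case_sum (\<lambda>x. Inr (line x)) (\<lambda>l. Inl (inv_into V line l))"

lemma card_line: "v \<in> V \<Longrightarrow> card (line v) = q + 1"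
  using defect_0[of v] by (simp add: defect_def)

lemma line_commute: "u \<in> V \<Longrightarrow> v \<in> V \<Longrightarrow> u \<in> line v \<longleftrightarrow> v \<in> line u"
  using sym by (auto simp: line_def)

lemma common_point_unique:
  assumes "u \<in> V" "v \<in> V" "u \<noteq> v" "a \<in> line u \<inter> line v" "b \<in> line u \<inter> line v"
  shows "a = b"
proof -
  have "card {a, b} \<le> meet u v" unfolding meet_def using assms by (intro card_mono) auto
  then show ?thesis using meet_1[OF assms(1-3)] by (cases "a = b") auto
qed

lemma common_point_exists:
  assumes "u \<in> V" "v \<in> V" "u \<noteq> v"
  shows "\<exists>a. a \<in> line u \<inter> line v"
  using meet_1[OF assms] by (auto simp: meet_def card_1_singleton_iff)

lemma inj_line: "inj_on line V"
proof (rule inj_onI, rule ccontr)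
  fix u v assume h: "u \<in> V" "v \<in> V" "line u = line v" "u \<noteq> v"
  then show False using meet_1[of u v] card_line[of u] q_pos by (simp add: meet_def)
qed

lemma projective_plane_lines: "projective_plane q V (line ` V)"
  unfolding projective_plane_def
proof (intro conjI ballI impI)
  show "card V = q\<^sup>2 + q + 1" by (rule card_V)
  show "l \<subseteq> V" if "l \<in> line ` V" for l using that line_subset by auto
  show "card l = q + 1" if "l \<in> line ` V" for l using that card_line by auto
  show "card {l \<in> line ` V. x \<in> l} = q + 1" if x: "x \<in> V" for x
  proof -
    have "{l \<in> line ` V. x \<in> l} = line ` {v \<in> V. x \<in> line v}" by auto
    also have "{v \<in> V. x \<in> line v} = line x"
      using line_subset[of x] line_commute[OF x] by blast
    finally have "{l \<in> line ` V. x \<in> l} = line ` line x" .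
    moreover have "inj_on line (line x)" using inj_on_subset[OF inj_line line_subset] .
    ultimately show ?thesis using card_line[OF x] by (simp add: card_image)
  qed
  show "card (l \<inter> k) = 1" if "l \<in> line ` V" "k \<in> line ` V" "l \<noteq> k" for l k
    using that meet_1 by (auto simp: meet_def)
qed

lemma polarity_pol: "polarity V (line ` V) pol"
proof -
  have l: "pol (Inl x) = Inr (line x)" for x by (simp add: pol_def)
  have r: "pol (Inr (line x)) = Inl x" if "x \<in> V" for x
    using that by (simp add: pol_def inv_into_f_f[OF inj_line])
  have inv: "\<forall>z \<in> V <+> line ` V. pol (pol z) = z" using l r by auto
  have maps: "pol ` (V <+> line ` V) \<subseteq> V <+> line ` V" using l r by auto
  show ?thesis unfolding polarity_def
  proof (intro conjI ballI impI)
    show "bij_betw pol (V <+> line ` V) (V <+> line ` V)"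
      by (rule bij_betw_byWitness[OF inv inv maps maps])
    show "pol (pol z) = z" if "z \<in> V <+> line ` V" for z using inv that by blast
    show "pol ` Inl ` V = Inr ` line ` V" by (simp add: image_image l)
    show "pol ` Inr ` line ` V = Inl ` V" by (simp add: image_image r cong: image_cong)
    show "projl (pol (Inr l')) \<in> projr (pol (Inl x))" if x: "x \<in> V" "l' \<in> line ` V" "x \<in> l'" for x l'
    proof -
      obtain v where "v \<in> V" "l' = line v" using x by auto
      then show ?thesis using x line_commute[of x v] by (simp add: l r)
    qed
  qed
qed

lemma absolute_pol: "{x \<in> V. x \<in> projr (pol (Inl x))} = absolute"
  by (simp add: absolute_def pol_def)

lemma verts_polarity_graph: "verts (polarity_graph V pol) = V"
  by (simp add: polarity_graph_def verts_def)

lemma edges_polarity_graph: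
  "{x, y} \<in> edges (polarity_graph V pol) \<longleftrightarrow> x \<in> V \<and> x \<noteq> y \<and> y \<in> line x"
proof -
  have "{x, y} \<in> edges (polarity_graph V pol) \<longleftrightarrow>
      (\<exists>a b. {x, y} = {a, b} \<and> a \<in> V \<and> b \<in> V \<and> a \<noteq> b \<and> a \<in> line b)"
    by (simp add: polarity_graph_def edges_def pol_def)
  also have "\<dots> \<longleftrightarrow> x \<in> V \<and> x \<noteq> y \<and> y \<in> line x"
    using line_commute[of x y] line_subset[of x] line_subset[of y] by (auto simp: doubleton_eq_iff)
  finally show ?thesis .
qed

lemma edge_polarity_graph:
  "e \<in> edges (polarity_graph V pol) \<Longrightarrow> e \<subseteq> V \<and> card e = 2"
  by (auto simp: polarity_graph_def edges_def)

text \<open>With a loop at each absolute point all degrees are \<open>q + 1\<close>.\<close>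

lemma card_edges_polarity_graph:
  "2 * card (edges (polarity_graph V pol)) + card absolute = (q + 1) * (q\<^sup>2 + q + 1)"
proof -
  have "2 * card (edges (polarity_graph V pol)) = (\<Sum>v\<in>V. card {w \<in> V. {v, w} \<in> edges (polarity_graph V pol)})"
    by (rule handshake[OF fin edge_polarity_graph, symmetric])
  also have "\<dots> = (\<Sum>v\<in>V. card (line v - {v}))"
  proof (rule sum.cong[OF refl])
    fix v assume "v \<in> V"
    then have "{w \<in> V. {v, w} \<in> edges (polarity_graph V pol)} = line v - {v}"
      using line_subset by (auto simp: edges_polarity_graph)
    then show "card {w \<in> V. {v, w} \<in> edges (polarity_graph V pol)} = card (line v - {v})" by simp
  qed
  finally have 1: "2 * card (edges (polarity_graph V pol)) = (\<Sum>v\<in>V. card (line v - {v}))" .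
  have "card absolute = (\<Sum>v\<in>V. if v \<in> absolute then 1 else 0)"
  proof -
    have "V \<inter> absolute = absolute" by (auto simp: absolute_def)
    then show ?thesis using fin by (simp add: sum.If_cases)
  qed
  then have "2 * card (edges (polarity_graph V pol)) + card absolute
      = (\<Sum>v\<in>V. card (line v - {v}) + (if v \<in> absolute then 1 else 0))"
    using 1 by (simp add: sum.distrib)
  also have "\<dots> = (\<Sum>v\<in>V. q + 1)"
    by (rule sum.cong[OF refl]) (simp add: absolute_def card_line)
  finally show ?thesis by (simp add: card_V)
qed

text \<open>If \<open>v\<close> is not absolute, then \<open>p \<mapsto> line p \<inter> line v\<close> is an involution of the set \<open>line v\<close> of
  odd size. So every line contains an absolute point, and the absolute points block all lines.\<close>

lemma card_absolute_ge:
  assumes "even q"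
  shows "q + 1 \<le> card absolute"
proof -
  have "V \<subseteq> (\<Union>a\<in>absolute. line a)"
  proof
    fix v assume v: "v \<in> V"
    have "\<exists>a\<in>absolute. a \<in> line v"
    proof (cases "v \<in> line v")
      case True
      then show ?thesis using v by (auto simp: absolute_def)
    next
      case False
      have "\<forall>p\<in>line v. \<exists>p'. p' \<in> line p \<inter> line v"
        using common_point_exists[OF _ v] line_subset[of v] False by blast
      then obtain h where h: "\<And>p. p \<in> line v \<Longrightarrow> h p \<in> line p \<inter> line v" by metis
      have "\<exists>p\<in>line v. h p = p"
      proof (rule involution_fixed_point)
        show "odd (card (line v))" using assms card_line[OF v] by simp
        show hv: "h p \<in> line v" if "p \<in> line v" for p using h[OF that] by auto
        show "h (h p) = p" if p: "p \<in> line v" for p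
        proof (rule common_point_unique)
          show "h p \<in> V" "v \<in> V" "h p \<noteq> v" using hv[OF p] line_subset v False by auto
          show "h (h p) \<in> line (h p) \<inter> line v" using h[OF hv[OF p]] .
          have "p \<in> V" using p line_subset by auto
          then show "p \<in> line (h p) \<inter> line v" using h[OF p] p line_sym[of p "h p"] by auto
        qed
      qed
      then obtain p where p: "p \<in> line v" "h p = p" by auto
      then have "p \<in> absolute" using h[of p] line_subset by (auto simp: absolute_def)
      then show ?thesis using p by auto
    qed
    then show "v \<in> (\<Union>a\<in>absolute. line a)" using line_sym[OF v] by auto
  qed
  moreover have fa: "finite absolute" using fin by (simp add: absolute_def)
  ultimately have "card V \<le> card (\<Union>a\<in>absolute. line a)" by (intro card_mono) auto
  also have "\<dots> \<le> (\<Sum>a\<in>absolute. card (line a))" by (rule card_UN_le[OF fa])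
  also have "\<dots> = (\<Sum>a\<in>absolute. q + 1)" by (rule sum.cong) (auto simp: absolute_def card_line)
  finally have "q * (q + 1) + 1 \<le> card absolute * (q + 1)"
    unfolding card_V by (simp add: power2_eq_square)
  then have "q * (q + 1) < card absolute * (q + 1)" by linarith
  then show ?thesis by (simp only: mult_less_cancel2 Suc_eq_plus1[symmetric] Suc_le_eq)
qed

lemma orthogonal_polarity_graph_pol:
  "card absolute = q + 1 \<Longrightarrow> orthogonal_polarity_graph q (polarity_graph V pol)"
  unfolding orthogonal_polarity_graph_def orthogonal_polarity_def
  by (intro exI[of _ V] exI[of _ "line ` V"] exI[of _ pol])
    (simp add: projective_plane_lines polarity_pol absolute_pol)


text \<open>Without \<open>M\<close> there are \<open>q - 1\<close> such paths; they are pairwise edge-disjoint, so each edge of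
  \<open>M\<close> destroys at most one of them.\<close>

lemma three_paths:
  assumes V: "x \<in> V" "y \<in> V" and xy: "x \<noteq> y" "y \<notin> line x" and finM: "finite M"
  obtains A b where "A \<subseteq> V" "q - 1 - card M \<le> card A"
    "\<forall>a\<in>A. {{x, a}, {a, b a}, {b a, y}} \<subseteq> edges (polarity_graph V pol) - M \<and> a \<noteq> y \<and> b a \<noteq> x"
proof -
  define A0 where "A0 = line x - ({x} \<union> (line x \<inter> line y))"
  have A0V: "A0 \<subseteq> V" using line_subset by (auto simp: A0_def)
  have finA0: "finite A0" by (simp add: A0_def)
  have "card ({x} \<union> (line x \<inter> line y)) \<le> 2"
    using card_Un_le[of "{x}" "line x \<inter> line y"] meet_1[OF V xy(1)] by (simp add: meet_def)
  moreover have "card (line x) - card ({x} \<union> (line x \<inter> line y)) \<le> card A0"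
    unfolding A0_def by (rule diff_card_le_card_Diff) simp
  ultimately have cA0: "q - 1 \<le> card A0" using card_line[OF V(1)] by linarith
  have A0: "a \<in> V" "a \<noteq> x" "a \<noteq> y" "a \<notin> line y" "a \<in> line x" if "a \<in> A0" for a
    using that line_subset xy by (auto simp: A0_def)
  have xny: "x \<notin> line y" using xy line_commute[OF V] by simp
  have "\<forall>a\<in>A0. \<exists>b. b \<in> line a \<inter> line y" using common_point_exists[OF _ V(2)] A0 by blast
  then obtain b where b: "\<And>a. a \<in> A0 \<Longrightarrow> b a \<in> line a \<inter> line y" by metis
  have b': "b a \<in> V" "b a \<noteq> x" "b a \<noteq> y" "b a \<noteq> a" "a \<in> line (b a)" if a: "a \<in> A0" for a
  proof -
    show "b a \<in> V" using b[OF a] line_subset by auto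
    show "b a \<noteq> x" using b[OF a] xny by auto
    show "b a \<noteq> y" using b[OF a] A0[OF a] line_commute[OF A0(1)[OF a] V(2)] by auto
    show "b a \<noteq> a" using b[OF a] A0[OF a] by auto
    show "a \<in> line (b a)" using line_sym[OF A0(1)[OF a], of "b a"] b[OF a] by simp
  qed
  have inj_b: "a = a'" if a: "a \<in> A0" "a' \<in> A0" "b a = b a'" for a a'
    using common_point_unique[OF b'(1)[OF a(1)] V(1) b'(2)[OF a(1)], of a a']
      b'(5)[OF a(1)] b'(5)[OF a(2)] A0(5)[OF a(1)] A0(5)[OF a(2)] a(3) by simp
  have by': "b a \<in> line y" if "a \<in> A0" for a using b[OF that] by simp
  define P where "P = (\<lambda>a. {{x, a}, {a, b a}, {b a, y}})"
  have disj: "a = a'" if a: "a \<in> A0" "a' \<in> A0" and e: "e \<in> P a" "e \<in> P a'" for a a' e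
  proof -
    have ne: "a \<noteq> b a'" "a' \<noteq> b a" using by'[OF a(1)] by'[OF a(2)] A0(4)[OF a(1)] A0(4)[OF a(2)] by metis+
    have ne': "a \<noteq> x" "a \<noteq> y" "a' \<noteq> x" "a' \<noteq> y" "b a \<noteq> x" "b a \<noteq> y" "b a' \<noteq> x" "b a' \<noteq> y"
      using A0(2,3)[OF a(1)] A0(2,3)[OF a(2)] b'(2,3)[OF a(1)] b'(2,3)[OF a(2)] by blast+
    have "e = {x, a} \<or> e = {a, b a} \<or> e = {b a, y}" "e = {x, a'} \<or> e = {a', b a'} \<or> e = {b a', y}"
      using e by (simp_all add: P_def)
    then have "a = a' \<or> b a = b a'"
      using ne ne' xy(1) by (elim disjE; simp only: doubleton_eq_iff; blast)
    then show ?thesis using inj_b[OF a] by blast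
  qed
  define bad where "bad = {a \<in> A0. P a \<inter> M \<noteq> {}}"
  have "\<forall>a\<in>bad. \<exists>e. e \<in> P a \<inter> M" by (auto simp: bad_def)
  then obtain c where c: "\<And>a. a \<in> bad \<Longrightarrow> c a \<in> P a \<inter> M" by metis
  have "inj_on c bad"
  proof (rule inj_onI)
    fix a a' assume h: "a \<in> bad" "a' \<in> bad" "c a = c a'"
    have "a \<in> A0" "a' \<in> A0" "c a \<in> P a" "c a \<in> P a'" using h c[OF h(1)] c[OF h(2)] by (simp_all add: bad_def)
    then show "a = a'" by (rule disj)
  qed
  then have "card bad \<le> card M" using c finM by (intro card_inj_on_le) auto
  moreover have "card A0 - card bad \<le> card (A0 - bad)"
    by (rule diff_card_le_card_Diff) (simp add: bad_def finA0)
  ultimately have "q - 1 - card M \<le> card (A0 - bad)" using cA0 by linarith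
  moreover have "P a \<subseteq> edges (polarity_graph V pol) - M \<and> a \<noteq> y \<and> b a \<noteq> x" if a: "a \<in> A0 - bad" for a
  proof -
    have a0: "a \<in> A0" using a by simp
    have "y \<in> line (b a)" using by'[OF a0] line_commute[OF b'(1)[OF a0] V(2)] by simp
    then have "P a \<subseteq> edges (polarity_graph V pol)"
      using A0[OF a0] b[OF a0] b'(1-4)[OF a0] V by (simp add: P_def edges_polarity_graph)
    then show ?thesis using a A0(3)[OF a0] b'(2)[OF a0] by (auto simp: bad_def)
  qed
  ultimately show ?thesis using A0V by (intro that[of "A0 - bad" b]) (auto simp: P_def)
qed

lemma C4_copies_ge:
  assumes G: "simple_graph G" "verts G = V"
  shows "card (edges G - edges (polarity_graph V pol)) * (q - 1 - card (edges (polarity_graph V pol) - edges G))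
    \<le> card (C4_copies G)"
proof -
  define EH where "EH = edges (polarity_graph V pol)"
  define N where "N = edges G - EH"
  define M where "M = EH - edges G"
  have finEH: "finite EH"
    by (rule finite_subset[of _ "Pow V"]) (use fin edge_polarity_graph in \<open>auto simp: EH_def\<close>)
  have finM: "finite M" using finEH by (simp add: M_def)
  have finN: "finite N" using finite_edges[OF G(1)] by (simp add: N_def)
  \<comment> \<open>Bundles the choices for an edge \<open>e\<close>. A fixed orientation
    \<open>x\<close>, \<open>y\<close> is among them, because a path read backwards gives the same
    quadrilateral.\<close>
  define joins where "joins = (\<lambda>e x y A (b :: 'a \<Rightarrow> 'a). {y, x} = e \<and> x \<noteq> y \<and> finite A \<and> q - 1 - card M \<le> card A \<and>
      (\<forall>a\<in>A. {{x, a}, {a, b a}, {b a, y}} \<subseteq> EH - M \<and> a \<noteq> y \<and> b a \<noteq> x))"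
  have "\<exists>x y A b. joins e x y A b" if e: "e \<in> N" for e
  proof -
    have eG: "e \<subseteq> V" "card e = 2" using e G by (auto simp: N_def simple_graph_def)
    obtain x y where xy: "e = {x, y}" "x \<noteq> y" using eG(2) unfolding card_2_iff by blast
    have V: "x \<in> V" "y \<in> V" using eG xy by auto
    have yx: "y \<notin> line x" using e V xy edges_polarity_graph[of x y] by (auto simp: N_def EH_def)
    obtain A b where A: "A \<subseteq> V" "q - 1 - card M \<le> card A"
      "\<forall>a\<in>A. {{x, a}, {a, b a}, {b a, y}} \<subseteq> edges (polarity_graph V pol) - M \<and> a \<noteq> y \<and> b a \<noteq> x"
      using three_paths[OF V xy(2) yx finM] .
    have "joins e x y A b"
      unfolding joins_def
    proof (intro conjI)
      show "{y, x} = e" using xy(1) by auto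
      show "finite A" by (rule finite_subset[OF A(1) fin])
      show "\<forall>a\<in>A. {{x, a}, {a, b a}, {b a, y}} \<subseteq> EH - M \<and> a \<noteq> y \<and> b a \<noteq> x"
        using A(3) unfolding EH_def .
    qed (fact xy(2) A(2))+
    then show ?thesis by blast
  qed
  then obtain X Y A b where J: "\<And>e. e \<in> N \<Longrightarrow> joins e (X e) (Y e) (A e) (b e)" by metis
  have XY: "{Y e, X e} = e" "X e \<noteq> Y e" "finite (A e)" "q - 1 - card M \<le> card (A e)" if "e \<in> N" for e
    using J[OF that] by (simp_all add: joins_def)
  have paths: "{{X e, a}, {a, b e a}, {b e a, Y e}} \<subseteq> EH - M" "a \<noteq> Y e" "b e a \<noteq> X e"
    if "e \<in> N" "a \<in> A e" for e a
    using J[OF that(1)] that(2) by (simp_all add: joins_def)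
  define F where "F = (\<lambda>(e, a). ({X e, a, b e a, Y e}, {{X e, a}, {a, b e a}, {b e a, Y e}, {Y e, X e}}))"
  have img: "F ` (Sigma N A) \<subseteq> C4_copies G"
  proof
    fix H assume "H \<in> F ` (Sigma N A)"
    then obtain e a where ea: "e \<in> N" "a \<in> A e" "H = F (e, a)" by auto
    have "EH - M \<subseteq> edges G" by (auto simp: M_def)
    then have sub: "{{X e, a}, {a, b e a}, {b e a, Y e}} \<subseteq> edges G"
      using paths(1)[OF ea(1,2)] by (rule order_trans[rotated])
    have "{Y e, X e} \<in> edges G" unfolding XY(1)[OF ea(1)] using ea(1) by (simp add: N_def)
    then show "H \<in> C4_copies G"
      unfolding ea(3) F_def prod.case using sub paths(2,3)[OF ea(1,2)]
      by (intro C4_copyI[OF G(1)]) simp_all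
  qed
  have "inj_on F (Sigma N A)"
  proof (rule inj_onI)
    fix z z' assume z: "z \<in> Sigma N A" "z' \<in> Sigma N A" and eq: "F z = F z'"
    obtain e a where ea: "z = (e, a)" "e \<in> N" "a \<in> A e" using z(1) by blast
    obtain e' a' where ea': "z' = (e', a')" "e' \<in> N" "a' \<in> A e'" using z(2) by blast
    \<comment> \<open>The copy determines \<open>e\<close> as its only edge outside the polarity
      graph.\<close>
    have new: "snd (F (e, a)) - EH = {e}" if h: "e \<in> N" "a \<in> A e" for e a
    proof -
      have "snd (F (e, a)) = {{X e, a}, {a, b e a}, {b e a, Y e}} \<union> {e}"
        unfolding F_def prod.case snd_conv XY(1)[OF h(1)] by blast
      moreover have "S \<union> {e} - EH = {e}" if "S \<subseteq> EH - M" for S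
        using that h(1) by (auto simp: N_def)
      ultimately show ?thesis using paths(1)[OF h] by metis
    qed
    have F: "F (e, a) = F (e', a')" using eq unfolding ea(1) ea'(1) .
    have e: "e = e'" using new[OF ea(2,3)] new[OF ea'(2,3)] unfolding F by simp
    have a': "a' \<in> A e" using ea' e by simp
    have "X e \<noteq> a'"
    proof
      assume "X e = a'"
      then have "{a'} \<in> EH" using paths(1)[OF ea(2) a'] by simp
      then show False using edge_polarity_graph[of "{a'}"] by (simp add: EH_def)
    qed
    moreover have "{X e, a} \<in> snd (F (e', a'))" unfolding F[symmetric] by (simp add: F_def)
    then have "{X e, a} \<in> snd (F (e, a'))" by (simp only: e)
    \<comment> \<open>The vertex \<open>X e\<close> lies on just two edges of the copy; the one that
      does not lead to \<open>Y e\<close> determines \<open>a\<close>.\<close>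
    then have "{X e, a} = {X e, a'} \<or> {X e, a} = {a', b e a'} \<or> {X e, a} = {b e a', Y e} \<or> {X e, a} = {Y e, X e}"
      by (simp only: F_def prod.case snd_conv insert_iff empty_iff simp_thms)
    moreover have "c = c'"
      if "{x, c} = {x, c'} \<or> {x, c} = {c', d} \<or> {x, c} = {d, y} \<or> {x, c} = {y, x}"
        "x \<noteq> c'" "x \<noteq> y" "d \<noteq> x" "c \<noteq> y" for x y c c' d :: 'a
      using that by (auto simp: doubleton_eq_iff)
    ultimately have "a = a'"
      using paths(2)[OF ea(2,3)] paths(3)[OF ea(2) a'] XY(2)[OF ea(2)] by metis
    then show "z = z'" using e ea ea' by simp
  qed
  then have "card (Sigma N A) \<le> card (C4_copies G)"
    using img finite_C4_copies[OF G(1)] by (rule card_inj_on_le)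
  moreover have "card (Sigma N A) = (\<Sum>e\<in>N. card (A e))" using finN XY(3) by simp
  moreover have "(\<Sum>e\<in>N. q - 1 - card M) \<le> (\<Sum>e\<in>N. card (A e))" by (rule sum_mono) (rule XY(4))
  ultimately show ?thesis by (simp add: N_def M_def EH_def)
qed

end

section \<open>From a dense graph to a polarity\<close>

context dense_structure
begin

lemma near_polarity:
  assumes large: "10000000000000000000 * m ^ 4 \<le> q"
  obtains R' where "polarity_structure V R' q"
    "card {(u, v) \<in> V \<times> V. u \<noteq> v \<and> R' u v \<and> \<not> R u v} \<le> 5200 * (235 * m)\<^sup>2"
proof -
  have q: "10000 * (235 * m) \<le> q" using m_le by linarith
  have q1: "1 \<le> q" using m_le by linarith
  have m: "1 \<le> 235 * m" using m_pos by simp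
  obtain R1 where R1: "sym_structure V R1 q" "\<forall>u v. u \<noteq> v \<longrightarrow> (R1 u v \<longleftrightarrow> R u v)"
    "(\<Sum>v\<in>V. \<bar>sym_structure.defect V R1 q v\<bar>) \<le> int (235 * m)"
    "(\<Sum>v\<in>V. sym_structure.excess V R1 v) \<le> 235 * m * q"
    using add_loops .
  obtain R2 where R2: "sym_structure V R2 q" "\<forall>u v. R2 u v \<longrightarrow> R1 u v"
    "\<forall>u\<in>V. \<forall>b\<in>V. u \<noteq> b \<longrightarrow> sym_structure.meet V R2 u b \<le> 1"
    "(\<Sum>v\<in>V. \<bar>sym_structure.defect V R2 q v\<bar>) \<le> int (5200 * (235 * m)\<^sup>2)"
    using sym_structure.prune[OF R1(1,3,4) m q] .
  \<comment> \<open>This is the condition of \<open>sparse_structure\<close> for the number of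
    missing flags left by \<open>prune\<close>, applied with \<open>235 * m\<close> from
    \<open>add_loops\<close>; the constant in \<open>large\<close> is a power of ten above
    it.\<close>
  have "100 * (5200 * (235 * m)\<^sup>2)\<^sup>2 = 8246660890000000000 * m ^ 4"
    by (simp add: power_mult_distrib flip: power_mult)
  then have "100 * (5200 * (235 * m)\<^sup>2)\<^sup>2 \<le> q" using large by linarith
  then have sparse: "sparse_structure V R2 q (5200 * (235 * m)\<^sup>2)"
    using R2(1,3,4) m_pos by (intro sparse_structure.intro sparse_structure_axioms.intro) simp_all
  obtain R3 where R3: "sym_structure V R3 q"
    "\<forall>v\<in>V. sym_structure.defect V R3 q v = 0"
    "\<forall>u\<in>V. \<forall>v\<in>V. u \<noteq> v \<longrightarrow> sym_structure.meet V R3 u v = 1"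
    "card {(u, v) \<in> V \<times> V. R3 u v \<and> \<not> R2 u v} \<le> 5200 * (235 * m)\<^sup>2"
    using sparse_structure.completion[OF sparse] .
  have "{(u, v) \<in> V \<times> V. u \<noteq> v \<and> R3 u v \<and> \<not> R u v} \<subseteq> {(u, v) \<in> V \<times> V. R3 u v \<and> \<not> R2 u v}"
    using R1(2) R2(2) by blast
  then have "card {(u, v) \<in> V \<times> V. u \<noteq> v \<and> R3 u v \<and> \<not> R u v} \<le> card {(u, v) \<in> V \<times> V. R3 u v \<and> \<not> R2 u v}"
    using fin by (intro card_mono) (auto intro: finite_subset[of _ "V \<times> V"])
  then have "card {(u, v) \<in> V \<times> V. u \<noteq> v \<and> R3 u v \<and> \<not> R u v} \<le> 5200 * (235 * m)\<^sup>2"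
    using R3(4) by linarith
  moreover have "polarity_structure V R3 q"
    using R3(1-3) q1 by (intro polarity_structure.intro polarity_structure_axioms.intro) simp_all
  ultimately show ?thesis using that[of R3] by simp
qed

end

section \<open>Supersaturation\<close>

lemma supersaturation:
  assumes G: "simple_graph G" "card (verts G) = q\<^sup>2 + q + 1"
    and ed: "2 * card (edges G) = q * (q + 1)\<^sup>2 + 2 * t"
    and "even q" "1 \<le> t" and large: "10000000000000000000 * (256 * (t + 1)) ^ 4 \<le> q"
  shows "(int (card (C4_copies G)) \<ge> (int t + 1) * int q - (int t + 1)\<^sup>2 \<or>
      (\<exists>H. orthogonal_polarity_graph q H \<and> obtained_by_adding_edges t H G)) \<and>
    int (card (C4_copies G)) \<ge> int t * (int q - 1)"
proof (cases "int (card (C4_copies G)) \<ge> (int t + 1) * int q - (int t + 1)\<^sup>2")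
  case True
  have "(t + 1)\<^sup>2 * 1 \<le> (t + 1)\<^sup>2 * (t + 1)\<^sup>2" by (intro mult_left_mono) auto
  then have "(t + 1)\<^sup>2 \<le> (t + 1) ^ 4" by (simp add: power_add[of _ 2 2, simplified])
  also have "\<dots> \<le> (256 * (t + 1)) ^ 4" by (rule power_mono) auto
  finally have "(t + 1)\<^sup>2 \<le> q" using large by linarith
  then have "int ((t + 1)\<^sup>2) \<le> int q" by (rule of_nat_mono)
  then have "(int t + 1)\<^sup>2 \<le> int q" by (simp add: add.commute)
  then have "int t * (int q - 1) \<le> (int t + 1) * int q - (int t + 1)\<^sup>2" by (simp add: algebra_simps)
  then show ?thesis using True by linarith
next
  case False
  define c where "c = card (C4_copies G)"
  \<comment> \<open>The excess is at most \<open>256 * c\<close> with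
    \<open>c < (t + 1) * q\<close>, and the defects sum to \<open>q + 1 - 2 * t\<close>; this
    \<open>m\<close> covers both.\<close>
  define m where "m = 256 * (t + 1)"
  define V where "V = verts G"
  define R where "R = (\<lambda>u v. {u, v} \<in> edges G)"
  have E: "e \<subseteq> V \<and> card e = 2" if "e \<in> edges G" for e
    using G that by (auto simp: simple_graph_def V_def)
  have finV: "finite V" using G by (simp add: V_def simple_graph_def)
  interpret sym_structure V R q
    by standard (use finV G in \<open>auto simp: V_def R_def insert_commute\<close>)
  have "int c < int ((t + 1) * q)"
  proof -
    have "int c < (int t + 1) * int q - (int t + 1)\<^sup>2" using False by (simp add: c_def)
    moreover have "0 \<le> (int t + 1)\<^sup>2" by simp
    moreover have "int ((t + 1) * q) = (int t + 1) * int q" by (simp add: algebra_simps)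
    ultimately show ?thesis by linarith
  qed
  then have c: "c < (t + 1) * q" by (simp only: of_nat_less_iff)
  have sum_line: "(\<Sum>v\<in>V. card (line v)) = 2 * card (edges G)"
  proof -
    have "line v = {w \<in> V. {v, w} \<in> edges G}" for v unfolding line_def by (simp add: R_def)
    then show ?thesis using handshake[OF finV, of "edges G"] E by simp
  qed
  have "(\<Sum>v\<in>V. defect v) = (int q + 1) * int (card V) - int (\<Sum>v\<in>V. card (line v))"
    by (simp add: defect_def sum_subtractf mult.commute)
  also have "\<dots> = (int q + 1) * (int q * int q + int q + 1) - int (q * (q + 1)\<^sup>2 + 2 * t)"
    unfolding sum_line ed card_V by (simp add: power2_eq_square)
  also have "\<dots> = int q + 1 - 2 * int t" by (simp add: power2_eq_square algebra_simps)
  finally have sd: "(\<Sum>v\<in>V. defect v) = int q + 1 - 2 * int t" .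
  have m2: "10000000000 * m\<^sup>2 \<le> q"
  proof -
    have "m\<^sup>2 * 1 \<le> m\<^sup>2 * m\<^sup>2" by (intro mult_left_mono) (auto simp: m_def)
    then have "m\<^sup>2 \<le> m ^ 4" by (simp add: power_add[of _ 2 2, simplified])
    then show ?thesis using large unfolding m_def by linarith
  qed
  interpret dense_structure V R q m
  proof
    show "\<not> R v v" for v using E[of "{v}"] by (auto simp: R_def)
    show "even q" by fact
    show "1 \<le> m" by (simp add: m_def)
    show "(\<Sum>v\<in>V. defect v) \<le> int q + 1" "int q + 1 - int m \<le> (\<Sum>v\<in>V. defect v)"
      unfolding sd by (simp_all add: m_def)
    show "(\<Sum>v\<in>V. excess v) \<le> m * q"
    proof -
      have "(\<Sum>v\<in>V. excess v) \<le> 256 * c"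
        using excess_le_C4_copies[OF G] unfolding V_def R_def c_def .
      moreover have "m * q = 256 * ((t + 1) * q)" by (simp only: m_def mult.assoc)
      ultimately show ?thesis using c by linarith
    qed
    show "10000000000 * m\<^sup>2 \<le> q" by (rule m2)
  qed
  obtain R' where R': "polarity_structure V R' q"
    and few: "card {(u, v) \<in> V \<times> V. u \<noteq> v \<and> R' u v \<and> \<not> R u v} \<le> 5200 * (235 * m)\<^sup>2"
    using near_polarity large unfolding m_def by blast
  interpret P: polarity_structure V R' q by (rule R')
  define H where "H = polarity_graph V P.pol"
  define r where "r = card (edges G - edges H)"
  define s where "s = card (edges H - edges G)"
  have finE: "finite (edges G)" by (rule finite_edges[OF G(1)])
  have finH: "finite (edges H)"
    by (rule finite_subset[of _ "Pow V"]) (use finV P.edge_polarity_graph in \<open>auto simp: H_def\<close>)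
  have r: "card (edges G) = r + card (edges G \<inter> edges H)"
    unfolding r_def using card_Int_Diff[OF finE, of "edges H"] by simp
  have s: "card (edges H) = s + card (edges G \<inter> edges H)"
    unfolding s_def using card_Int_Diff[OF finH, of "edges G"] by (simp add: Int_commute)
  have "2 * card (edges H) + card P.absolute = q * (q + 1)\<^sup>2 + (q + 1)"
    using P.card_edges_polarity_graph by (simp add: H_def power2_eq_square algebra_simps)
  \<comment> \<open>Every absolute point beyond \<open>q + 1\<close> costs the polarity graph half
    an edge. So \<open>r >= t + s\<close>, and if \<open>s = 0\<close>, then \<open>r = t\<close>
    exactly when the polarity is orthogonal.\<close>
  then have rs: "2 * r + (q + 1) = 2 * t + 2 * s + card P.absolute"
    using ed r s by linarith
  have abs_ge: "q + 1 \<le> card P.absolute" by (rule P.card_absolute_ge) fact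
  have cnt: "r * (q - 1 - s) \<le> c"
    using P.C4_copies_ge[OF G(1)] by (simp add: V_def r_def s_def c_def H_def)
  have "s \<le> 5200 * (235 * m)\<^sup>2"
  proof -
    have "edges H - edges G \<subseteq> (\<lambda>(u, v). {u, v}) ` {(u, v) \<in> V \<times> V. u \<noteq> v \<and> R' u v \<and> \<not> R u v}"
    proof
      fix e assume e: "e \<in> edges H - edges G"
      then have "e \<subseteq> V" "card e = 2" using P.edge_polarity_graph by (auto simp: H_def)
      then obtain x y where xy: "e = {x, y}" "x \<in> V" "y \<in> V" unfolding card_2_iff by blast
      then have "x \<noteq> y" "y \<in> P.line x" using e P.edges_polarity_graph[of x y] by (auto simp: H_def)
      then have "(x, y) \<in> {(u, v) \<in> V \<times> V. u \<noteq> v \<and> R' u v \<and> \<not> R u v}"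
        using xy e by (simp add: P.line_def R_def)
      then show "e \<in> (\<lambda>(u, v). {u, v}) ` {(u, v) \<in> V \<times> V. u \<noteq> v \<and> R' u v \<and> \<not> R u v}"
        unfolding xy(1) by (rule rev_image_eqI) simp
    qed
    then have "s \<le> card {(u, v) \<in> V \<times> V. u \<noteq> v \<and> R' u v \<and> \<not> R u v}"
      unfolding s_def by (rule surj_card_le[rotated]) (use finV in \<open>auto intro: finite_subset[of _ "V \<times> V"]\<close>)
    then show ?thesis using few by linarith
  qed
  moreover have "5200 * (235 * m)\<^sup>2 = 287170000 * m\<^sup>2" by (simp add: power_mult_distrib)
  moreover have "m \<le> m\<^sup>2" by (rule self_le_power) (simp_all add: m_def)
  moreover have "t + 2 \<le> m" by (simp add: m_def)
  ultimately have sq: "s + t + 2 \<le> q" using m2 by linarith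
  have qi: "int (q - 1 - s) = int q - 1 - int s" using sq by linarith
  have cnt': "int r * (int q - 1 - int s) \<le> int c"
    using of_nat_mono[OF cnt, where 'a = int] unfolding of_nat_mult qi .
  show ?thesis
  proof (cases "s = 0 \<and> card P.absolute = q + 1")
    case True
    then have rt: "r = t" using rs by linarith
    have "edges H \<subseteq> edges G" using True finH by (auto simp: s_def)
    then have "edges G = edges H \<union> (edges G - edges H)" by auto
    then have "obtained_by_adding_edges t H G"
      unfolding obtained_by_adding_edges_def using G(1) finE rt P.verts_polarity_graph
      by (intro conjI exI[of _ "edges G - edges H"]) (auto simp: r_def H_def V_def)
    moreover have "orthogonal_polarity_graph q H"
      unfolding H_def by (rule P.orthogonal_polarity_graph_pol) (use True in simp)
    moreover have "int t * (int q - 1) \<le> int (card (C4_copies G))"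
      using cnt' True rt by (simp add: c_def)
    ultimately show ?thesis by blast
  next
    case False': False
    have "int (t + 1) * (int q - 2) \<le> int c"
    proof (cases "s = 0")
      case True
      then have "t + 1 \<le> r" using False' rs abs_ge by linarith
      then have "int (t + 1) * (int q - 2) \<le> int r * (int q - 1 - int s)"
        using True sq by (intro mult_mono) auto
      then show ?thesis using cnt' by linarith
    next
      case False
      have "t + s \<le> r" using rs abs_ge by linarith
      then have "int (t + s) * (int q - 1 - int s) \<le> int r * (int q - 1 - int s)"
        using sq by (intro mult_right_mono) auto
      \<comment> \<open>This is the amount by which \<open>(t + s) * (q - 1 - s)\<close> exceeds its
        value at \<open>s = 1\<close>, so a single missing edge is the worst case.\<close>
      moreover have "0 \<le> (int s - 1) * (int q - 2 - int s - int t)"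
        using sq False by (intro mult_nonneg_nonneg) linarith+
      moreover have "int (t + s) * (int q - 1 - int s) = int (t + 1) * (int q - 2) + (int s - 1) * (int q - 2 - int s - int t)"
        by (simp add: algebra_simps)
      ultimately show ?thesis using cnt' by linarith
    qed
    moreover have "(int t + 1) * int q - (int t + 1)\<^sup>2 \<le> int (t + 1) * (int q - 2)"
    proof -
      have "(int t + 1) * 2 \<le> (int t + 1) * (int t + 1)" using \<open>1 \<le> t\<close> by (intro mult_left_mono) auto
      then show ?thesis by (simp add: power2_eq_square algebra_simps)
    qed
    ultimately show ?thesis using False by (simp add: c_def)
  qed
qed

theorem theorem9p1:
  shows "\<exists>q0::nat. \<forall>q::nat. \<forall>t::nat.
    even q \<and> q0 \<le> q \<and> 1 \<le> t \<and> real t < real q powr (1 / 8) / 30 \<longrightarrow>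
    (\<forall>G :: 'a graph.
       simple_graph G \<and> card (verts G) = q\<^sup>2 + q + 1 \<and>
       real (card (edges G)) = 1 / 2 * real q * (real q + 1)\<^sup>2 + real t \<longrightarrow>
       (int (card (C4_copies G)) \<ge> (int t + 1) * int q - (int t + 1)\<^sup>2 \<or>
        (\<exists>H. orthogonal_polarity_graph q H \<and> obtained_by_adding_edges t H G)) \<and>
       int (card (C4_copies G)) \<ge> int t * (int q - 1))"
proof (rule exI[of _ "(10000000000000000000 * 256 ^ 4)\<^sup>2"], intro allI impI, elim conjE)
  \<comment> \<open>Both \<open>C\<close> and \<open>(t + 1)^4\<close> are at most the square root
    of \<open>q\<close>: the former by the choice of the threshold, the latter by the eighth root in
    the hypothesis. So their product is at most \<open>q\<close>.\<close>
  define C :: nat where "C = 10000000000000000000 * 256 ^ 4"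
  fix q t :: nat and G :: "'a graph"
  assume q: "even q" "(10000000000000000000 * 256 ^ 4)\<^sup>2 \<le> q" and t: "1 \<le> t" "real t < real q powr (1 / 8) / 30"
    and G: "simple_graph G" "card (verts G) = q\<^sup>2 + q + 1"
    and ed: "real (card (edges G)) = 1 / 2 * real q * (real q + 1)\<^sup>2 + real t"
  have Cq: "C\<^sup>2 \<le> q" using q(2) by (simp only: C_def)
  have "0 < C\<^sup>2" by (simp add: C_def)
  then have q0: "0 < q" using Cq by linarith
  have "real (t + 1) \<le> real q powr (1 / 8)" using t by simp
  then have "real (t + 1) ^ 8 \<le> (real q powr (1 / 8)) ^ 8" by (intro power_mono) auto
  also have "\<dots> = real q powr (1 / 8 * real 8)" using q0 by (simp flip: powr_realpow add: powr_powr)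
  finally have "real ((t + 1) ^ 8) \<le> real q" using q0 by simp
  then have t8: "(t + 1) ^ 8 \<le> q" by (simp only: of_nat_le_iff)
  have "(C * (t + 1) ^ 4)\<^sup>2 = C\<^sup>2 * (t + 1) ^ 8" by (simp add: power_mult_distrib flip: power_mult)
  also have "\<dots> \<le> q * q" using Cq t8 by (rule mult_le_mono)
  finally have "(C * (t + 1) ^ 4)\<^sup>2 \<le> q\<^sup>2" by (simp add: power2_eq_square)
  then have "C * (t + 1) ^ 4 \<le> q" by (rule power2_le_imp_le) simp
  then have large: "10000000000000000000 * (256 * (t + 1)) ^ 4 \<le> q"
    by (simp only: C_def power_mult_distrib mult.assoc)
  have "real (2 * card (edges G)) = real (q * (q + 1)\<^sup>2 + 2 * t)" using ed by (simp add: algebra_simps)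
  then have "2 * card (edges G) = q * (q + 1)\<^sup>2 + 2 * t" by (simp only: of_nat_eq_iff)
  then show "((int t + 1) * int q - (int t + 1)\<^sup>2 \<le> int (card (C4_copies G)) \<or>
      (\<exists>H. orthogonal_polarity_graph q H \<and> obtained_by_adding_edges t H G)) \<and>
    int t * (int q - 1) \<le> int (card (C4_copies G))"
    by (rule supersaturation[OF G _ q(1) t(1) large])
qed

end
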